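(* Assume: (A 1) $G(\theta,\cdot)$ is Borel measurable for every $\theta\in\Theta$; (A 2) there is a strictly positive, Borel measurable, $\mathbb{P}^{Z}$-integrable mapping $\xi:\mathbb{R}^{d}\to\mathbb{R}$ with $\sup_{\theta\in\Theta}|G(\theta,z)|\le\xi(z)$ for all $z\in\mathbb{R}^{d}$; (A 3) there exist an at most countable subset $\overline{\Theta}\subseteq\Theta$ and $(\mathbb{P}^{Z})^{n}$-null sets $N_{n}$ ($n\in\mathbb{N}$) such that $$\inf_{\vartheta\in\overline{\Theta}}\big|\mathbb{E}[G(\vartheta,Z_{1})]-\mathbb{E}[G(\theta,Z_{1})]\big|=\inf_{\vartheta\in\overline{\Theta}}\max_{j\in\{1,\dots,n\}}|G(\theta,z_{j})-G(\vartheta,z_{j})|=0$$ for all $n\in\mathbb{N}$, $\theta\in\Theta$ and $(z_{1},\dots,z_{n})\in\mathbb{R}^{dn}\setminus N_{n}$. Suppose that $\xi$ from (A 2) is square $\mathbb{P}^{Z}$-integrable and that $J(\mathbb{F}^{\Theta},\xi,1/2)<\infty$. Let $\varepsilon>0$ be fixed. For $t>0$ and $n\in\mathbb{N}$ put $$\eta_{t,n}:=\frac{\|\xi\|_{\mathbb{P}^{Z},2}}{\sqrt{n}}+\frac{32\sqrt{2}\,(1+t)\,\|\xi\|_{\mathbb{P}^{Z},2}\,J(\mathbb{F}^{\Theta},\xi,1/4)}{\sqrt{n}}.$$ Then, with $\overline{\Theta}$ from (A 3), for every $t>0$ and every $n\in\mathbb{N}$ with $\varepsilon>\eta_{t,n}$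 and $n\ge\|\xi\|_{\mathbb{P}^{Z},2}^{2}/2$, $$\mathbb{P}\Big(\Big|\inf_{\theta\in\Theta}\frac1n\sum_{j=1}^{n}G(\theta,Z_{j})-\inf_{\theta\in\Theta}\mathbb{E}[G(\theta,Z_{1})]\Big|\ge\varepsilon\Big)\le\mathbb{P}\Big(\sup_{\theta\in\overline{\Theta}}\Big|\frac1n\sum_{j=1}^{n}G(\theta,Z_{j})-\mathbb{E}[G(\theta,Z_{1})]\Big|\ge\varepsilon\Big)$$ $$\le\exp\Big(\frac{-t\sqrt{n}\,\varepsilon}{8(t+1)\|\xi\|_{\mathbb{P}^{Z},2}}\cdot\mathfrak{f}_{n}(t)\Big)+\mathbb{P}(\Omega\setminus B_{n}^{\xi}).$$
   Context: Let $m,d\in\mathbb{N}$, let $\Theta\subseteq\mathbb{R}^{m}$ be nonempty and compact, let $(\Omega,\mathcal{F},\mathbb{P})$ be an atomless complete probability space, and let $(Z_{j})_{j\in\mathbb{N}}$ be i.i.d. $d$-dimensional random vectors on it with common distribution $\mathbb{P}^{Z}$. Let $G:\Theta\times\mathbb{R}^{d}\to\mathbb{R}$ and $\mathbb{F}^{\Theta}:=\{G(\theta,\cdot)\mid\theta\in\Theta\}$. For a probability measure $\mathbb{Q}$ on $\mathcal{B}(\mathbb{R}^{d})$, $\|\cdot\|_{\mathbb{Q},p}$ is the $L^{p}(\mathbb{Q})$-norm. For a nonempty set $\mathbb{F}$ of Borel measurable functions $\mathbb{R}^{d}\to\mathbb{R}$, $N(\eta,\mathbb{F},L^{p}(\mathbb{Q}))$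 is the minimal number of closed $L^{p}(\mathbb{Q})$-balls of radius $\eta>0$ with centers in $\mathbb{F}$ needed to cover $\mathbb{F}$ ($\infty$ if there is no finite cover). A positive envelope of $\mathbb{F}$ is a Borel measurable $C_{\mathbb{F}}:\mathbb{R}^{d}\to\,]0,\infty[$ with $\sup_{h\in\mathbb{F}}|h|\le C_{\mathbb{F}}$. $\mathcal{M}_{\mathrm{fin}}$ is the set of probability measures on $\mathcal{B}(\mathbb{R}^{d})$ with finite support, and $$J(\mathbb{F},C_{\mathbb{F}},\delta):=\int_{0}^{\delta}\sup_{\mathbb{Q}\in\mathcal{M}_{\mathrm{fin}}}\sqrt{\ln\big(2N(\varepsilon\|C_{\mathbb{F}}\|_{\mathbb{Q},2},\mathbb{F},L^{2}(\mathbb{Q}))\big)}\,d\varepsilon .$$ For square $\mathbb{P}^{Z}$-integrable strictly positive $\xi$: $B_{n}^{\xi}:=\big\{\frac1n\sum_{j=1}^{n}\xi(Z_{j})^{2}\le2\,\mathbb{E}[\xi(Z_{1})^{2}]\big\}$. For $t>0$, with $\vee$ denoting maximum, $$\mathfrak{f}_{n}(t):=\frac{3\sqrt{n}\,\ln\big(1+t/(5t+17)\big)}{2(\sqrt{2n}+1)}\vee\frac{t}{5t+28}.$$ *)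

theory Defs
  imports "HOL-Probability.Probability"
begin

definition atomless :: "'a measure \<Rightarrow> bool" where
  "atomless M \<longleftrightarrow>
     (\<forall>A\<in>sets M. emeasure M A > 0 \<longrightarrow>
        (\<exists>B\<in>sets M. B \<subseteq> A \<and> 0 < emeasure M B \<and> emeasure M B < emeasure M A))"

(* Meaningful only when f is in L^p(Q): otherwise the Bochner integral, and hence
   this real number, is 0.  Lp_cball therefore demands integrability separately. *)
definition Lp_norm :: "'a measure \<Rightarrow> real \<Rightarrow> ('a \<Rightarrow> real) \<Rightarrow> real" where
  "Lp_norm Q p f = (LINT x|Q. \<bar>f x\<bar> powr p) powr (1 / p)"

definition Lp_cball ::
    "'a measure \<Rightarrow> real \<Rightarrow> ('a \<Rightarrow> real) \<Rightarrow> real \<Rightarrow> ('a \<Rightarrow> real) set" where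
  "Lp_cball Q p g r =
     {h \<in> borel_measurable Q. integrable Q (\<lambda>x. \<bar>h x - g x\<bar> powr p) \<and>
        Lp_norm Q p (\<lambda>x. h x - g x) \<le> r}"

(* T is the set of centers; without a finite cover the infimum is over the empty
   set, hence \<infinity>. *)
definition covering_number ::
    "real \<Rightarrow> ('a \<Rightarrow> real) set \<Rightarrow> 'a measure \<Rightarrow> real \<Rightarrow> enat" where
  "covering_number r F Q p =
     (INF T \<in> {T. finite T \<and> T \<subseteq> F \<and> F \<subseteq> (\<Union>g\<in>T. Lp_cball Q p g r)}. enat (card T))"

definition M_fin :: "'a::topological_space measure set" where
  "M_fin = {Q. prob_space Q \<and> sets Q = sets borel \<and>
     (\<exists>S\<in>sets borel. finite S \<and> emeasure Q S = 1)}"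

definition sqrt_ln_twice :: "enat \<Rightarrow> ennreal" where
  "sqrt_ln_twice N = (case N of enat k \<Rightarrow> ennreal (sqrt (ln (2 * real k))) | \<infinity> \<Rightarrow> \<infinity>)"

definition J_integral ::
    "('a::topological_space \<Rightarrow> real) set \<Rightarrow> ('a \<Rightarrow> real) \<Rightarrow> real \<Rightarrow> ennreal" where
  "J_integral F C \<delta> =
     (\<integral>\<^sup>+ e \<in> {0<..\<delta>}.
        (SUP Q \<in> M_fin. sqrt_ln_twice (covering_number (e * Lp_norm Q 2 C) F Q 2)) \<partial>lborel)"

(* Samples are indexed from 1, as in Z_1, Z_2, ... *)
definition emp_mean :: "(nat \<Rightarrow> 'w \<Rightarrow> 'a) \<Rightarrow> nat \<Rightarrow> ('a \<Rightarrow> real) \<Rightarrow> 'w \<Rightarrow> real" where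
  "emp_mean Z n f \<omega> = (1 / real n) * (\<Sum>j = 1..n. f (Z j \<omega>))"

definition B_event ::
    "'w measure \<Rightarrow> (nat \<Rightarrow> 'w \<Rightarrow> 'a) \<Rightarrow> ('a \<Rightarrow> real) \<Rightarrow> nat \<Rightarrow> 'w set" where
  "B_event M Z \<xi> n =
     {\<omega> \<in> space M. emp_mean Z n (\<lambda>z. (\<xi> z)\<^sup>2) \<omega> \<le> 2 * (LINT \<omega>'|M. (\<xi> (Z 1 \<omega>'))\<^sup>2)}"

definition frak_f :: "nat \<Rightarrow> real \<Rightarrow> real" where
  "frak_f n t =
     max (3 * sqrt (real n) * ln (1 + t / (5 * t + 17)) / (2 * (sqrt (2 * real n) + 1)))
         (t / (5 * t + 28))"

(* The conversion of J to a real number is harmless where J is finite. *)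
definition eta_bound ::
    "'a::topological_space measure \<Rightarrow> ('a \<Rightarrow> real) set \<Rightarrow> ('a \<Rightarrow> real) \<Rightarrow> real \<Rightarrow> nat \<Rightarrow> real" where
  "eta_bound PZ F \<xi> t n =
     Lp_norm PZ 2 \<xi> / sqrt (real n)
     + 32 * sqrt 2 * (1 + t) * Lp_norm PZ 2 \<xi> * enn2real (J_integral F \<xi> (1 / 4))
         / sqrt (real n)"

end

theory Submission
  imports Defs
begin

text \<open>
Put \<open>\<tau> = \<parallel>\<xi>\<parallel>\<close> and \<open>s = sqrt n * \<epsilon> / \<tau>\<close>, so that \<open>s > 1 + 32 * sqrt 2 * J\<close>. Since
\<open>frak_f n t \<le> 6/25\<close>, the exponential in the claim is at least \<open>exp (- (3/100) * s)\<close>, which is so weak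
that no concentration inequality of Talagrand type is needed. On the event \<open>B_n\<close>, compare the
sample with a ghost sample conditioned on its own version of \<open>B_n\<close>: this event has probability at
least 1/2 and biases the ghost mean by at most \<open>\<tau> / sqrt n\<close>, the first summand of \<open>\<eta>\<close>. By Jensen,
the probability is controlled by the expected excess of the symmetrized supremum over the level
\<open>c = 36 * J + (3/40) * s\<close>. Both samples together satisfy \<open>\<Sum> \<xi>\<^sup>2 \<le> 4 n \<tau>\<^sup>2\<close>, a condition invariant
under swapping the samples, so for fixed data the signs form a sub-Gaussian process whose expected
excess over \<open>c\<close> is at most \<open>exp (- (3/100) * s) / 2\<close> by chaining.
\<close>

text \<open>The constants, not the rate, are the delicate point. In units of \<tau> / sqrt n the
  hypothesis grants only \<open>32 * sqrt 2\<close>, a little more than 45, times \<open>J\<close>,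
  and \<open>J\<close> integrates the entropy only up to 1/4, whereas the chain has to start from
  the zero function at distance 1. Chaining costs 36 \<open>J\<close>: 24 for the dyadic sum and 12
  for the root, whose entropy number is at most 4 \<open>J\<close> by monotonicity. What is left
  pays for the bias of the ghost mean, for the share 3/40 s and for the excess that must remain. The
  latter are fixed numbers; they can be absorbed because ln (2 N) \<ge> ln 2 forces \<open>J\<close>
  \<ge> 1/5. Measurability dictates a second distinction. Everything that is integrated involves
  only a countable subclass; the full class enters for fixed data, since the centers of the covering
  balls lie in it.\<close>

section \<open>Rademacher sums\<close>

text \<open>A set of indices \<open>\<sigma>\<close> encodes the Rademacher signs that are -1 exactly on \<open>\<sigma>\<close>; expectations over
  the signs become sums over \<open>Pow I\<close>.\<close>

definition rsign :: "'i set \<Rightarrow> 'i \<Rightarrow> real" where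
  "rsign \<sigma> j = (if j \<in> \<sigma> then - 1 else 1)"

text \<open>Two-point case of Hoeffding's lemma: the logarithmic inequality behind it, at
  probability 1/2 and parameter 2 x, becomes the claim after exponentiation and multiplication by
  exp (- x). It covers x \<ge> 0; evenness gives the rest.\<close>

lemma cosh_le_exp_half_square: "(exp x + exp (- x)) / 2 \<le> exp (x\<^sup>2 / 2)" for x :: real
proof -
  have *: "(exp x + exp (- x)) / 2 \<le> exp (x\<^sup>2 / 2)" if "x \<ge> 0" for x :: real
  proof -
    have "- (2 * x) * (1/2) + ln (1 + 1/2 * (exp (2 * x) - 1)) \<le> (2 * x)\<^sup>2 / 8"
      using Hoeffdings_lemma_aux[of "2 * x" "1/2"] that by simp
    then have "ln ((1 + exp (2 * x)) / 2) \<le> x + x\<^sup>2 / 2"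
      by (simp add: field_simps power2_eq_square)
    moreover have "(1 + exp (2 * x)) / 2 > 0" by (intro divide_pos_pos add_pos_pos) auto
    ultimately have "(1 + exp (2 * x)) / 2 \<le> exp (x + x\<^sup>2 / 2)"
      by (metis exp_le_cancel_iff exp_ln)
    then have "exp (- x) * ((1 + exp (2 * x)) / 2) \<le> exp (- x) * exp (x + x\<^sup>2 / 2)"
      by (intro mult_left_mono) auto
    then show ?thesis by (simp add: field_simps flip: exp_add)
  qed
  show ?thesis using *[of x] *[of "- x"] by (cases "x \<ge> 0") (auto simp: add.commute)
qed

text \<open>Independence of the signs in finite form: expanding a product of two-term factors
  amounts to choosing the set of indices with sign -1.\<close>

lemma sum_Pow_exp_rsign:
  fixes a :: "'i \<Rightarrow> real"
  assumes "finite I"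
  shows "(\<Sum>\<sigma>\<in>Pow I. exp (\<Sum>j\<in>I. rsign \<sigma> j * a j)) = (\<Prod>j\<in>I. exp (- a j) + exp (a j))"
proof -
  have "exp (\<Sum>j\<in>I. rsign \<sigma> j * a j) = (\<Prod>j\<in>\<sigma>. exp (- a j)) * (\<Prod>j\<in>I - \<sigma>. exp (a j))"
    if "\<sigma> \<in> Pow I" for \<sigma>
  proof -
    have "(\<Sum>j\<in>I. rsign \<sigma> j * a j) = (\<Sum>j\<in>\<sigma>. rsign \<sigma> j * a j) + (\<Sum>j\<in>I-\<sigma>. rsign \<sigma> j * a j)"
      using that assms by (subst sum.subset_diff[of \<sigma> I]) auto
    also have "\<dots> = (\<Sum>j\<in>\<sigma>. - a j) + (\<Sum>j\<in>I-\<sigma>. a j)"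
      by (intro arg_cong2[where f="(+)"] sum.cong) (auto simp: rsign_def)
    finally show ?thesis
      using assms that by (simp add: exp_add exp_sum finite_subset del: sum_negf)
  qed
  then show ?thesis by (simp add: prod_add[OF assms])
qed

lemma rademacher_mgf:
  fixes a :: "'i \<Rightarrow> real"
  assumes "finite I"
  shows "(\<Sum>\<sigma>\<in>Pow I. exp (\<Sum>j\<in>I. rsign \<sigma> j * a j)) \<le> 2 ^ card I * exp ((\<Sum>j\<in>I. (a j)\<^sup>2) / 2)"
proof -
  have "(\<Prod>j\<in>I. exp (- a j) + exp (a j)) \<le> (\<Prod>j\<in>I. 2 * exp ((a j)\<^sup>2 / 2))"
    using cosh_le_exp_half_square by (intro prod_mono) (auto simp: field_simps add_nonneg_nonneg)
  also have "\<dots> = 2 ^ card I * exp ((\<Sum>j\<in>I. (a j)\<^sup>2) / 2)"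
    using assms by (simp add: prod.distrib exp_sum sum_divide_distrib)
  finally show ?thesis using sum_Pow_exp_rsign[OF assms] by simp
qed

text \<open>Chernoff's method for the expected excess instead of the tail: u \<le> exp (u - 1) at u
  = \<theta> (|Y| - l) bounds the excess by exponential moments, and \<theta> = l / v minimizes
  \<theta>^2 v / 2 - \<theta> l. Using both \<theta> and -\<theta> removes the absolute value and
  produces the factor 2.\<close>

lemma rademacher_excess:
  fixes a :: "'i \<Rightarrow> real"
  assumes I: "finite I" and v: "(\<Sum>j\<in>I. (a j)\<^sup>2) \<le> v" "v > 0" and l: "l > 0"
  shows "(\<Sum>\<sigma>\<in>Pow I. max 0 (\<bar>\<Sum>j\<in>I. rsign \<sigma> j * a j\<bar> - l))
    \<le> 2 ^ card I * (2 * (v / l) * exp (- 1 - l\<^sup>2 / (2 * v)))"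
proof -
  define \<theta> where "\<theta> = l / v"
  have \<theta>: "\<theta> > 0" using v l by (simp add: \<theta>_def)
  let ?Y = "\<lambda>\<sigma>. \<Sum>j\<in>I. rsign \<sigma> j * a j"
  let ?e = "\<lambda>r \<sigma>. exp (\<Sum>j\<in>I. rsign \<sigma> j * (r * a j))"
  have mgf: "(\<Sum>\<sigma>\<in>Pow I. ?e r \<sigma>) \<le> 2 ^ card I * exp (\<theta>\<^sup>2 * v / 2)" if "r\<^sup>2 = \<theta>\<^sup>2" for r
  proof -
    have "(\<Sum>\<sigma>\<in>Pow I. ?e r \<sigma>) \<le> 2 ^ card I * exp ((\<Sum>j\<in>I. (r * a j)\<^sup>2) / 2)"
      by (rule rademacher_mgf[OF I])
    also have "(\<Sum>j\<in>I. (r * a j)\<^sup>2) = \<theta>\<^sup>2 * (\<Sum>j\<in>I. (a j)\<^sup>2)"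
      by (simp add: power_mult_distrib sum_distrib_left that)
    also have "2 ^ card I * exp (\<theta>\<^sup>2 * (\<Sum>j\<in>I. (a j)\<^sup>2) / 2) \<le> 2 ^ card I * exp (\<theta>\<^sup>2 * v / 2)"
      using v by (auto intro!: mult_left_mono)
    finally show ?thesis .
  qed
  have pt: "max 0 (\<bar>?Y \<sigma>\<bar> - l) \<le> exp (- 1 - \<theta> * l) / \<theta> * (?e \<theta> \<sigma> + ?e (- \<theta>) \<sigma>)" for \<sigma>
  proof -
    have e: "?e r \<sigma> = exp (r * ?Y \<sigma>)" for r by (simp add: sum_distrib_left mult_ac)
    have "\<theta> * (\<bar>?Y \<sigma>\<bar> - l) \<le> exp (\<theta> * (\<bar>?Y \<sigma>\<bar> - l) - 1)"
      using exp_ge_add_one_self[of "\<theta> * (\<bar>?Y \<sigma>\<bar> - l) - 1"] by simp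
    also have "\<dots> = exp (- 1 - \<theta> * l) * exp (\<theta> * \<bar>?Y \<sigma>\<bar>)"
      by (simp add: algebra_simps flip: exp_add)
    also have "\<dots> \<le> exp (- 1 - \<theta> * l) * (?e \<theta> \<sigma> + ?e (- \<theta>) \<sigma>)"
      unfolding e by (intro mult_left_mono) (auto simp: abs_if)
    finally have "\<bar>?Y \<sigma>\<bar> - l \<le> exp (- 1 - \<theta> * l) / \<theta> * (?e \<theta> \<sigma> + ?e (- \<theta>) \<sigma>)"
      using \<theta> by (simp add: field_simps)
    moreover have "0 \<le> exp (- 1 - \<theta> * l) / \<theta> * (?e \<theta> \<sigma> + ?e (- \<theta>) \<sigma>)"
      using \<theta> by (simp add: add_nonneg_nonneg)
    ultimately show ?thesis by simp
  qed
  have "(\<Sum>\<sigma>\<in>Pow I. max 0 (\<bar>?Y \<sigma>\<bar> - l))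
    \<le> exp (- 1 - \<theta> * l) / \<theta> * ((\<Sum>\<sigma>\<in>Pow I. ?e \<theta> \<sigma>) + (\<Sum>\<sigma>\<in>Pow I. ?e (- \<theta>) \<sigma>))"
    unfolding sum.distrib[symmetric] sum_distrib_left by (intro sum_mono pt)
  also have "\<dots> \<le> exp (- 1 - \<theta> * l) / \<theta> * (2 ^ card I * exp (\<theta>\<^sup>2 * v / 2) + 2 ^ card I * exp (\<theta>\<^sup>2 * v / 2))"
    using \<theta> by (intro mult_left_mono add_mono mgf) auto
  also have "\<dots> = 2 ^ card I * (2 * (1 / \<theta>) * (exp (- 1 - \<theta> * l) * exp (\<theta>\<^sup>2 * v / 2)))"
    by (simp add: field_simps)
  also have "exp (- 1 - \<theta> * l) * exp (\<theta>\<^sup>2 * v / 2) = exp (- 1 - l\<^sup>2 / (2 * v))"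
    unfolding exp_add[symmetric] using v by (simp add: \<theta>_def field_simps power2_eq_square)
  also have "1 / \<theta> = v / l" by (simp add: \<theta>_def)
  finally show ?thesis .
qed

section \<open>Chaining\<close>

lemma rsign_square: "(rsign \<sigma> j)\<^sup>2 = 1"
  by (simp add: rsign_def)

lemma chain_le:
  fixes Y :: "'f \<Rightarrow> real" and c :: "nat \<Rightarrow> real"
  assumes root: "\<And>g. g \<in> T 0 \<Longrightarrow> \<bar>Y g\<bar> \<le> b"
    and link: "\<And>k g. g \<in> T (Suc k) \<Longrightarrow> \<bar>Y g - Y (\<pi> k g)\<bar> \<le> c k"
    and \<pi>: "\<And>k g. g \<in> T (Suc k) \<Longrightarrow> \<pi> k g \<in> T k"
  shows "g \<in> T k \<Longrightarrow> \<bar>Y g\<bar> \<le> b + (\<Sum>i<k. c i)"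
proof (induction k arbitrary: g)
  case 0
  then show ?case using root by simp
next
  case (Suc k)
  then have "\<bar>Y (\<pi> k g)\<bar> \<le> b + (\<Sum>i<k. c i)" using \<pi>[of g k] by simp
  moreover have "\<bar>Y g - Y (\<pi> k g)\<bar> \<le> c k" using link[of g k] Suc by simp
  ultimately show ?case by simp
qed

lemma exp_numeric: "exp (- 1) \<le> (2/5::real)" "exp (- (5/6)) \<le> (1/2::real)"
proof -
  have "5/2 \<le> exp (1 :: real)" using exp_lower_Taylor_quadratic[of 1] by simp
  then show "exp (- 1) \<le> (2/5::real)" by (simp add: exp_minus divide_simps)
  have "2 \<le> exp (5/6 :: real)" using exp_lower_Taylor_quadratic[of "5/6"] by (simp add: power_divide)
  then show "exp (- (5/6)) \<le> (1/2::real)" by (simp add: exp_minus divide_simps)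
qed

text \<open>Origin of the allowance \<open>6 * h + s / 20\<close>. Since 36/16 = 9/4, the square
  beats the entropy term by 5/4 h^2 \<ge> 5/6; the cross term 3/80 h s is at least 3/100 s, and this
  is the decay rate of the final bound.\<close>

lemma link_exponent:
  fixes h s :: real
  assumes "h \<ge> 4/5" "h\<^sup>2 \<ge> 2/3" "s \<ge> 0"
  shows "h\<^sup>2 - (6 * h + s / 20)\<^sup>2 / 16 \<le> - (5/6) + - (3/100) * s"
proof -
  have "(4/5) * s \<le> h * s" using assms by (intro mult_right_mono) auto
  moreover have "(6 * h + s / 20)\<^sup>2 = 36 * h\<^sup>2 + 3/5 * (h * s) + s\<^sup>2 / 400"
    by (simp add: power2_eq_square algebra_simps)
  ultimately show ?thesis using assms zero_le_power2[of s] by linarith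
qed

text \<open>A union bound in expectation: excesses are summed over the net. The 2 in
  \<open>2 * real (card S)\<close> is the two-sided factor of \<open>rademacher_excess\<close>, and
  the 2 in ln (2 N) provides for it. The factor 1/3 is 5/3 * 2/5 * 1/2, from 8 / y \<le> 5/3, exp (-
  1) \<le> 2/5 and exp (- 5/6) \<le> 1/2.\<close>

lemma net_excess:
  fixes A :: "'f \<Rightarrow> 'i \<Rightarrow> real"
  assumes I: "finite I" and S: "finite S" and L: "L > 0"
    and A: "\<And>g. g \<in> S \<Longrightarrow> (\<Sum>j\<in>I. (A g j)\<^sup>2) \<le> 8 * L\<^sup>2"
    and N: "2 * real (card S) \<le> exp (h\<^sup>2)" and h: "h \<ge> 4/5" "h\<^sup>2 \<ge> 2/3" and s: "s \<ge> 0"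
  shows "(\<Sum>\<sigma>\<in>Pow I. \<Sum>g\<in>S. max 0 (\<bar>\<Sum>j\<in>I. rsign \<sigma> j * A g j\<bar> - L * (6 * h + s / 20)))
    \<le> 2 ^ card I * (L / 3 * exp (- (3/100) * s))"
proof -
  define y where "y = 6 * h + s / 20"
  have y: "y \<ge> 24/5" using h s by (simp add: y_def)
  have "(\<Sum>\<sigma>\<in>Pow I. \<Sum>g\<in>S. max 0 (\<bar>\<Sum>j\<in>I. rsign \<sigma> j * A g j\<bar> - L * y))
      = (\<Sum>g\<in>S. \<Sum>\<sigma>\<in>Pow I. max 0 (\<bar>\<Sum>j\<in>I. rsign \<sigma> j * A g j\<bar> - L * y))"
    by (rule sum.swap)
  also have "\<dots> \<le> (\<Sum>g\<in>S. 2 ^ card I * (2 * ((8 * L\<^sup>2) / (L * y)) * exp (- 1 - (L * y)\<^sup>2 / (2 * (8 * L\<^sup>2)))))"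
    using y L A by (intro sum_mono rademacher_excess I) auto
  also have "\<dots> = 2 ^ card I * (L * (8 / y) * exp (- 1)) * (2 * real (card S) * exp (- (y\<^sup>2 / 16)))"
  proof -
    have "exp (- 1 - (L * y)\<^sup>2 / (2 * (8 * L\<^sup>2))) = exp (- 1) * exp (- (y\<^sup>2 / 16))"
      using L by (simp add: power_mult_distrib flip: exp_add)
    moreover have "8 * L\<^sup>2 / (L * y) = L * (8 / y)" using L by (simp add: power2_eq_square)
    ultimately show ?thesis by (simp only: sum_constant) (simp add: mult_ac)
  qed
  also have "\<dots> \<le> 2 ^ card I * (L * (5/3) * (2/5)) * (exp (h\<^sup>2) * exp (- (y\<^sup>2 / 16)))"
    using y L N exp_numeric(1)
    by (intro mult_mono mult_left_mono) (auto simp: divide_simps)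
  also have "exp (h\<^sup>2) * exp (- (y\<^sup>2 / 16)) = exp (h\<^sup>2 - y\<^sup>2 / 16)" by (simp flip: exp_add)
  also have "\<dots> \<le> exp (- (5/6) + - (3/100) * s)"
    unfolding y_def exp_le_cancel_iff by (rule link_exponent[OF h s])
  also have "\<dots> \<le> 1/2 * exp (- (3/100) * s)"
    unfolding exp_add by (intro mult_right_mono exp_numeric) auto
  finally show ?thesis using L by (simp add: y_def mult_left_mono mult_ac)
qed

text \<open>The chain starts at the root 0, at distance 1 from every function, and proceeds through nets of
  radius \<open>(1/2) ^ (2 + k)\<close>. A link of length \<open>d\<close> into a net with entropy number \<open>h\<close> is granted
  \<open>d * (6 * h + s / 20)\<close>; only the expected excess over this allowance is collected in \<open>W\<close>. Since
  these excesses are summed with weights \<open>d\<close>, no extra allowance is needed at fine scales.\<close>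

lemma rademacher_chaining:
  fixes A :: "'f \<Rightarrow> 'i \<Rightarrow> real" and h :: "nat \<Rightarrow> real"
  assumes I: "finite I" and L: "L > 0" and s: "s \<ge> 0" and \<delta>: "\<delta> > 0"
    and T: "\<And>k. finite (T k)" "\<And>k. T k \<subseteq> F"
    and \<pi>: "\<And>k f. f \<in> F \<Longrightarrow> \<pi> k f \<in> T k"
    and A: "\<And>f. f \<in> F \<Longrightarrow> (\<Sum>j\<in>I. (A f j)\<^sup>2) \<le> 8 * L\<^sup>2"
    and A\<pi>: "\<And>f k. f \<in> F \<Longrightarrow> (\<Sum>j\<in>I. (A f j - A (\<pi> k f) j)\<^sup>2) \<le> 8 * (L * (1/2) ^ (2 + k))\<^sup>2"
    and N: "\<And>k. 2 * real (card (T k)) \<le> exp ((h k)\<^sup>2)"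
    and h: "\<And>k. h k \<ge> 4/5" "\<And>k. (h k)\<^sup>2 \<ge> 2/3"
    and x: "\<And>K. 6 * h 0 + s / 20 + (\<Sum>k<K. (1/2) ^ (2 + k) * (6 * h (Suc k) + s / 20)) \<le> x"
  obtains W :: "'i set \<Rightarrow> real" where "\<And>\<sigma>. W \<sigma> \<ge> 0"
    "\<And>\<sigma> f. f \<in> F \<Longrightarrow> \<bar>\<Sum>j\<in>I. rsign \<sigma> j * A f j\<bar> \<le> L * x + W \<sigma>"
    "(\<Sum>\<sigma>\<in>Pow I. W \<sigma>) \<le> 2 ^ card I * (L * (exp (- (3/100) * s) / 2) + \<delta>)"
proof -
  define r :: "nat \<Rightarrow> real" where "r k = (1/2) ^ (2 + k)" for k
  define y where "y k = 6 * h k + s / 20" for k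
  define Y where "Y \<sigma> f = (\<Sum>j\<in>I. rsign \<sigma> j * A f j)" for \<sigma> f
  have Y_diff: "Y \<sigma> f - Y \<sigma> g = (\<Sum>j\<in>I. rsign \<sigma> j * (A f j - A g j))" for \<sigma> f g
    by (simp add: Y_def right_diff_distrib sum_subtractf)
  have r: "r k > 0" for k by (simp add: r_def)
  \<comment> \<open>The chain stops at a level \<open>K\<close> where Cauchy-Schwarz bounds the
    remaining increment by \<delta> for every choice of signs, so that \<open>F\<close> may be
    infinite. The summand 1 keeps \<open>C\<close> positive even for empty \<open>I\<close>.\<close>
  define C where "C = sqrt (8 * card I) * L + 1"
  have C: "C > 0" using L by (simp add: C_def add_nonneg_pos)
  have "(\<lambda>k. (1/2::real) ^ k) \<longlonglongrightarrow> 0" by (rule LIMSEQ_power_zero) simp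
  moreover have "\<delta> / C > 0" using C \<delta> by simp
  ultimately obtain K where K0: "(1/2::real) ^ K < \<delta> / C"
    by (metis (no_types, lifting) eventually_sequentially order_tendstoD(2) order_refl)
  have "r K \<le> (1/2) ^ K" unfolding r_def by (intro power_decreasing) auto
  with K0 have "r K < \<delta> / C" by linarith
  with C have "r K * C < \<delta>" by (simp add: pos_less_divide_eq)
  then have K: "sqrt (8 * card I) * (L * r K) \<le> \<delta>" using r[of K] by (simp add: C_def algebra_simps)
  define E0 where "E0 \<sigma> = (\<Sum>g\<in>T 0. max 0 (\<bar>Y \<sigma> g\<bar> - L * y 0))" for \<sigma>
  define E where "E k \<sigma> = (\<Sum>g\<in>T (Suc k). max 0 (\<bar>Y \<sigma> g - Y \<sigma> (\<pi> k g)\<bar> - (L * r k) * y (Suc k)))" for k \<sigma>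
  define W where "W \<sigma> = E0 \<sigma> + (\<Sum>k<K. E k \<sigma>) + \<delta>" for \<sigma>
  show ?thesis
  proof
    show "W \<sigma> \<ge> 0" for \<sigma>
      using \<delta> unfolding W_def E0_def E_def by (intro add_nonneg_nonneg sum_nonneg) auto
    show "\<bar>\<Sum>j\<in>I. rsign \<sigma> j * A f j\<bar> \<le> L * x + W \<sigma>" if f: "f \<in> F" for \<sigma> f
    proof -
      \<comment> \<open>A single excess is at most the sum of all excesses over its net, so
        allowance plus that sum bounds every link at once.\<close>
      have "\<bar>Y \<sigma> (\<pi> K f)\<bar> \<le> (L * y 0 + E0 \<sigma>) + (\<Sum>i<K. (L * r i) * y (Suc i) + E i \<sigma>)"
      proof (rule chain_le[where T=T and \<pi>=\<pi>])
        show "\<bar>Y \<sigma> g\<bar> \<le> L * y 0 + E0 \<sigma>" if "g \<in> T 0" for g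
          using member_le_sum[of g "T 0" "\<lambda>g. max 0 (\<bar>Y \<sigma> g\<bar> - L * y 0)"] that T(1)
          by (simp add: E0_def)
        show "\<bar>Y \<sigma> g - Y \<sigma> (\<pi> k g)\<bar> \<le> (L * r k) * y (Suc k) + E k \<sigma>" if "g \<in> T (Suc k)" for k g
          using member_le_sum[of g "T (Suc k)" "\<lambda>g. max 0 (\<bar>Y \<sigma> g - Y \<sigma> (\<pi> k g)\<bar> - (L * r k) * y (Suc k))"]
            that T(1) by (simp add: E_def)
        show "\<pi> k g \<in> T k" if "g \<in> T (Suc k)" for k g using that T(2) \<pi> by blast
        show "\<pi> K f \<in> T K" using f \<pi> by blast
      qed
      also have "\<dots> = L * (y 0 + (\<Sum>i<K. r i * y (Suc i))) + (E0 \<sigma> + (\<Sum>i<K. E i \<sigma>))"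
        by (simp add: distrib_left sum_distrib_left sum.distrib mult.assoc)
      also have "\<dots> \<le> L * x + (E0 \<sigma> + (\<Sum>i<K. E i \<sigma>))"
        using x[of K] L by (intro add_right_mono mult_left_mono) (auto simp: y_def r_def)
      finally have 1: "\<bar>Y \<sigma> (\<pi> K f)\<bar> \<le> L * x + (E0 \<sigma> + (\<Sum>i<K. E i \<sigma>))" .
      have "\<bar>Y \<sigma> f - Y \<sigma> (\<pi> K f)\<bar> \<le> sqrt ((\<Sum>j\<in>I. (rsign \<sigma> j)\<^sup>2) * (\<Sum>j\<in>I. (A f j - A (\<pi> K f) j)\<^sup>2))"
        unfolding Y_diff
        by (rule real_le_rsqrt) (use Cauchy_Schwarz_ineq_sum[of "rsign \<sigma>" "\<lambda>j. A f j - A (\<pi> K f) j" I] in simp)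
      also have "(\<Sum>j\<in>I. (rsign \<sigma> j)\<^sup>2) = real (card I)" by (simp add: rsign_square)
      also have "sqrt (real (card I) * (\<Sum>j\<in>I. (A f j - A (\<pi> K f) j)\<^sup>2))
          \<le> sqrt (real (card I) * (8 * (L * r K)\<^sup>2))"
        using A\<pi>[OF f, of K] by (intro real_sqrt_le_mono mult_left_mono) (auto simp: r_def)
      also have "\<dots> = sqrt (8 * card I) * (L * r K)"
        using L r[of K] by (simp add: real_sqrt_mult)
      also have "\<dots> \<le> \<delta>" by (rule K)
      finally have "\<bar>Y \<sigma> f - Y \<sigma> (\<pi> K f)\<bar> \<le> \<delta>" .
      then have "\<bar>Y \<sigma> f\<bar> \<le> L * x + W \<sigma>" using 1 by (simp add: W_def)
      then show ?thesis by (simp add: Y_def)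
    qed
    have E0: "(\<Sum>\<sigma>\<in>Pow I. E0 \<sigma>) \<le> 2 ^ card I * (L / 3 * exp (- (3/100) * s))"
      unfolding E0_def Y_def y_def using T A by (intro net_excess I L N h s) auto
    have E: "(\<Sum>\<sigma>\<in>Pow I. E k \<sigma>) \<le> 2 ^ card I * (L * r k / 3 * exp (- (3/100) * s))" for k
      unfolding E_def Y_diff y_def using T A\<pi>[of _ k] r[of k] L
      by (intro net_excess I N h s) (auto simp: r_def)
    \<comment> \<open>The link lengths sum to less than 1/2, so root and links together contribute
      1/3 * (1 + 1/2) = 1/2.\<close>
    have "(\<Sum>k<K. r k) = 1/2 - (1/2) ^ Suc K"
      by (induction K) (auto simp: r_def)
    then have rsum: "(\<Sum>k<K. r k) \<le> 1/2" by simp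
    have "(\<Sum>\<sigma>\<in>Pow I. W \<sigma>) = (\<Sum>\<sigma>\<in>Pow I. E0 \<sigma>) + (\<Sum>k<K. \<Sum>\<sigma>\<in>Pow I. E k \<sigma>) + 2 ^ card I * \<delta>"
      using I by (simp add: W_def sum.distrib card_Pow sum.swap[of _ "Pow I"])
    also have "\<dots> \<le> 2 ^ card I * (L / 3 * exp (- (3/100) * s))
        + (\<Sum>k<K. 2 ^ card I * (L * r k / 3 * exp (- (3/100) * s))) + 2 ^ card I * \<delta>"
      by (intro add_mono E0 sum_mono E) auto
    also have "\<dots> = 2 ^ card I * (L / 3 * exp (- (3/100) * s) * (1 + (\<Sum>k<K. r k)) + \<delta>)"
    proof -
      have "(\<Sum>k<K. 2 ^ card I * (L * r k / 3 * exp (- (3/100) * s)))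
          = 2 ^ card I * (L / 3 * exp (- (3/100) * s)) * (\<Sum>k<K. r k)"
        unfolding sum_distrib_left by (intro sum.cong) auto
      then show ?thesis by (simp only:) (simp add: algebra_simps)
    qed
    also have "\<dots> \<le> 2 ^ card I * (L / 3 * exp (- (3/100) * s) * (1 + 1/2) + \<delta>)"
      using L rsum by (intro mult_left_mono add_mono) auto
    finally show "(\<Sum>\<sigma>\<in>Pow I. W \<sigma>) \<le> 2 ^ card I * (L * (exp (- (3/100) * s) / 2) + \<delta>)"
      by simp
  qed
qed

section \<open>The uniform entropy integral\<close>

definition sup_entropy :: "('a::topological_space \<Rightarrow> real) set \<Rightarrow> ('a \<Rightarrow> real) \<Rightarrow> real \<Rightarrow> ennreal" where
  "sup_entropy F C e = (SUP Q\<in>M_fin. sqrt_ln_twice (covering_number (e * Lp_norm Q 2 C) F Q 2))"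

lemma J_integral_eq: "J_integral F C \<delta> = (\<integral>\<^sup>+ e \<in> {0<..\<delta>}. sup_entropy F C e \<partial>lborel)"
  by (simp add: J_integral_def sup_entropy_def)

lemma Lp_norm_nonneg: "Lp_norm Q p f \<ge> 0"
  by (simp add: Lp_norm_def)

lemma Lp_cball_mono: "r \<le> r' \<Longrightarrow> Lp_cball Q p g r \<subseteq> Lp_cball Q p g r'"
  by (auto simp: Lp_cball_def)

lemma covering_number_antimono:
  assumes "r \<le> r'"
  shows "covering_number r' F Q p \<le> covering_number r F Q p"
  unfolding covering_number_def using Lp_cball_mono[OF assms]
  by (intro INF_superset_mono) (auto, blast)

lemma covering_number_ge_1:
  assumes "F \<noteq> {}"
  shows "covering_number r F Q p \<ge> 1"
  unfolding covering_number_def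
proof (rule INF_greatest)
  fix T assume "T \<in> {T. finite T \<and> T \<subseteq> F \<and> F \<subseteq> (\<Union>g\<in>T. Lp_cball Q p g r)}"
  with assms have "card T \<ge> 1" by (auto simp: Suc_le_eq card_gt_0_iff)
  then show "1 \<le> enat (card T)" by (simp add: one_enat_def)
qed

text \<open>A finite value rules out the empty infimum, which is infinite, and \<open>enat\<close>
  is well-ordered, so the infimum is a minimum.\<close>

lemma covering_number_attained:
  assumes "covering_number r F Q p = enat k"
  obtains T where "finite T" "T \<subseteq> F" "F \<subseteq> (\<Union>g\<in>T. Lp_cball Q p g r)" "card T = k"
proof -
  let ?A = "{T. finite T \<and> T \<subseteq> F \<and> F \<subseteq> (\<Union>g\<in>T. Lp_cball Q p g r)}"
  have "?A \<noteq> {}"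
  proof
    assume "?A = {}"
    then have "covering_number r F Q p = \<infinity>"
      unfolding covering_number_def by (simp only: image_empty Inf_empty top_enat_def)
    with assms show False by simp
  qed
  then obtain T0 where "T0 \<in> ?A" by blast
  then have "Inf ((\<lambda>T. enat (card T)) ` ?A) \<in> (\<lambda>T. enat (card T)) ` ?A"
    by (intro wellorder_InfI[of "enat (card T0)"]) blast
  with assms have "enat k \<in> (\<lambda>T. enat (card T)) ` ?A" by (simp add: covering_number_def)
  then show ?thesis using that by auto
qed

lemma sqrt_ln_twice_mono: "N \<le> N' \<Longrightarrow> sqrt_ln_twice N \<le> sqrt_ln_twice N'"
proof (cases N)
  case (enat k)
  assume "N \<le> N'"
  show ?thesis
  proof (cases N')
    case k': (enat k')
    with enat \<open>N \<le> N'\<close> have "k \<le> k'" by simp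
    then have "ln (2 * real k) \<le> ln (2 * real k')"
      \<comment> \<open>Here \<open>ln 0 = 0\<close>, and the logarithm is nonnegative at every
        other value involved.\<close>
      by (cases "k = 0"; cases "k' = 0") auto
    then show ?thesis by (simp add: sqrt_ln_twice_def enat k' ennreal_leI)
  qed (simp add: sqrt_ln_twice_def)
qed (simp add: sqrt_ln_twice_def)

section \<open>Comparison of the entropy integral with step sums\<close>

lemma sup_entropy_antimono:
  assumes "e \<le> e'"
  shows "sup_entropy F C e' \<le> sup_entropy F C e"
  unfolding sup_entropy_def
  by (intro SUP_mono' sqrt_ln_twice_mono covering_number_antimono mult_right_mono assms Lp_norm_nonneg)

text \<open>A lower Riemann sum of an antitone integrand. Additivity is applied only to the step
  functions, which are measurable; the integrand itself is compared with them by monotonicity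
  alone.\<close>

lemma J_integral_ge_step:
  assumes b: "decseq b" "\<And>k. b k > 0"
  shows "(\<Sum>k<K. ennreal (b k - b (Suc k)) * sup_entropy F C (b k)) \<le> J_integral F C (b 0)"
proof -
  let ?f = "\<lambda>k e. sup_entropy F C (b k) * indicator {b (Suc k)<..b k} e"
  have le: "(\<Sum>k<K. ?f k e) \<le> sup_entropy F C e * indicator {b K<..b 0} e" for e K
  proof (induction K)
    case (Suc K)
    have "b (Suc K) \<le> b K" "b K \<le> b 0" using b(1) by (auto simp: decseq_def)
    then have "sup_entropy F C e * indicator {b K<..b 0} e + ?f K e
        \<le> sup_entropy F C e * indicator {b (Suc K)<..b 0} e"
      using sup_entropy_antimono[of e "b K" F C] by (auto simp: indicator_def)
    then show ?case
      using add_right_mono[OF Suc, of "?f K e"] unfolding sum.lessThan_Suc by (rule order_trans[rotated])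
  qed simp
  have "(\<Sum>k<K. ennreal (b k - b (Suc k)) * sup_entropy F C (b k)) = (\<Sum>k<K. \<integral>\<^sup>+e. ?f k e \<partial>lborel)"
    using b(1) by (intro sum.cong) (auto simp: nn_integral_cmult_indicator mult.commute decseq_Suc_iff)
  also have "\<dots> = (\<integral>\<^sup>+e. (\<Sum>k<K. ?f k e) \<partial>lborel)" by (rule nn_integral_sum[symmetric]) simp
  also have "\<dots> \<le> J_integral F C (b 0)"
    unfolding J_integral_eq
  proof (rule nn_integral_mono)
    fix e
    have "indicator {b K<..b 0} e \<le> (indicator {0<..b 0} e :: ennreal)"
      using b(2)[of K] by (auto simp: indicator_def)
    then show "(\<Sum>k<K. ?f k e) \<le> sup_entropy F C e * indicator {0<..b 0} e"
      using le[where e=e and K=K] by (meson mult_left_mono order_trans zero_le)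
  qed
  finally show ?thesis .
qed

lemma J_integral_mono: "a \<le> b \<Longrightarrow> J_integral F C a \<le> J_integral F C b"
  unfolding J_integral_def by (intro nn_integral_mono) (auto simp: indicator_def)

text \<open>One rectangle below the antitone integrand. It yields finiteness of the entropy at each
  scale and, at a = 1/4, pays for the root of the chain, whose length 1 lies outside the range of
  integration.\<close>

lemma J_integral_ge_entropy:
  assumes "a \<ge> 0"
  shows "ennreal a * sup_entropy F C a \<le> J_integral F C a"
proof -
  have "ennreal a * sup_entropy F C a = (\<integral>\<^sup>+e. sup_entropy F C a * indicator {0<..a} e \<partial>lborel)"
    using assms by (simp add: nn_integral_cmult_indicator mult.commute)
  also have "\<dots> \<le> J_integral F C a"
    unfolding J_integral_eq
    by (intro nn_integral_mono) (auto simp: indicator_def intro: sup_entropy_antimono)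
  finally show ?thesis .
qed

lemma sup_entropy_finite:
  assumes "J_integral F C a < \<infinity>" "0 < e" "e \<le> a"
  shows "sup_entropy F C e < \<infinity>"
proof -
  have "ennreal e * sup_entropy F C e < \<infinity>"
    using J_integral_ge_entropy[of e F C] J_integral_mono[OF assms(3), of F C] assms by auto
  then show ?thesis
    using assms(2) by (auto simp: ennreal_mult_less_top)
qed

text \<open>The net depends on \<open>Q\<close>, its entropy bound does not; this uniformity allows
  nets for the random empirical measure. The lower bound ln 2 holds because a nonempty class needs
  at least one ball.\<close>

lemma net_exists:
  assumes "sup_entropy F C e < \<infinity>" "Q \<in> M_fin" "F \<noteq> {}"
  obtains T where "finite T" "T \<subseteq> F" "F \<subseteq> (\<Union>g\<in>T. Lp_cball Q 2 g (e * Lp_norm Q 2 C))"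
    "2 * real (card T) \<le> exp ((enn2real (sup_entropy F C e))\<^sup>2)"
    "(enn2real (sup_entropy F C e))\<^sup>2 \<ge> ln 2"
proof -
  let ?N = "covering_number (e * Lp_norm Q 2 C) F Q 2" and ?h = "enn2real (sup_entropy F C e)"
  have le: "sqrt_ln_twice ?N \<le> sup_entropy F C e"
    unfolding sup_entropy_def using assms(2) by (intro SUP_upper)
  have "?N \<noteq> \<infinity>"
  proof
    assume "?N = \<infinity>"
    with le assms(1) show False by (simp add: sqrt_ln_twice_def top_unique)
  qed
  then obtain k where k: "?N = enat k" by (cases ?N) auto
  have "k \<ge> 1" using covering_number_ge_1[OF assms(3), of "e * Lp_norm Q 2 C" Q 2] k
    by (simp add: one_enat_def)
  have "sqrt (ln (2 * real k)) \<le> ?h"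
    using enn2real_mono[OF le] assms(1) \<open>k \<ge> 1\<close> by (simp add: sqrt_ln_twice_def k)
  then have h: "ln (2 * real k) \<le> ?h\<^sup>2"
    by (rule sqrt_le_D)
  have "ln 2 \<le> ln (2 * real k)" using \<open>k \<ge> 1\<close> by simp
  with h have h2: "ln 2 \<le> ?h\<^sup>2" by linarith
  have "2 * real k \<le> exp (?h\<^sup>2)"
    using h \<open>k \<ge> 1\<close> exp_le_cancel_iff[of "ln (2 * real k)" "?h\<^sup>2"] by simp
  moreover obtain T where "finite T" "T \<subseteq> F"
    "F \<subseteq> (\<Union>g\<in>T. Lp_cball Q 2 g (e * Lp_norm Q 2 C))" "card T = k"
    using covering_number_attained[OF k] .
  ultimately show ?thesis using that h2 by simp
qed

section \<open>Chaining for the symmetrized empirical process\<close>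

text \<open>As an image measure it counts repeated sample points with multiplicity. The uniform
  measure lives on the full power set of \<open>I\<close>, which makes every \<open>z\<close>
  measurable.\<close>

definition emp_measure :: "'i set \<Rightarrow> ('i \<Rightarrow> 'a::topological_space) \<Rightarrow> 'a measure" where
  "emp_measure I z = distr (uniform_count_measure I) borel z"

lemma emp_measure_in_M_fin:
  fixes z :: "'i \<Rightarrow> 'a::t1_space"
  assumes "finite I" "I \<noteq> {}"
  shows "emp_measure I z \<in> M_fin"
proof -
  interpret U: prob_space "uniform_count_measure I"
    using assms by (intro prob_space_uniform_count_measure)
  have z: "z \<in> measurable (uniform_count_measure I) borel" by simp
  have S: "z ` I \<in> sets borel" using assms by (intro borel_closed finite_imp_closed) auto
  have "emeasure (emp_measure I z) (z ` I) = emeasure (uniform_count_measure I) (space (uniform_count_measure I))"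
    unfolding emp_measure_def
    by (subst emeasure_distr[OF z S]) (auto intro!: arg_cong[where f="emeasure _"] simp: space_uniform_count_measure)
  then have "emeasure (emp_measure I z) (z ` I) = 1" by (simp add: U.emeasure_space_1)
  moreover have "prob_space (emp_measure I z)"
    unfolding emp_measure_def by (rule U.prob_space_distr[OF z])
  ultimately show ?thesis
    using S assms unfolding M_fin_def by (auto simp: emp_measure_def intro!: exI[of _ "z ` I"])
qed

lemma Lp_norm_emp_measure:
  fixes z :: "'i \<Rightarrow> 'a::topological_space"
  assumes "finite I" and [measurable]: "f \<in> borel_measurable borel"
  shows "Lp_norm (emp_measure I z) 2 f = sqrt ((\<Sum>i\<in>I. (f (z i))\<^sup>2) / real (card I))"
proof -
  have "(LINT x|emp_measure I z. \<bar>f x\<bar> powr 2) = (LINT i|uniform_count_measure I. \<bar>f (z i)\<bar> powr 2)"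
    unfolding emp_measure_def by (rule integral_distr) auto
  also have "\<dots> = (\<Sum>i\<in>I. (f (z i))\<^sup>2) / real (card I)"
    using assms by (simp add: integral_uniform_count_measure)
  finally show ?thesis
    by (simp add: Lp_norm_def powr_half_sqrt sum_nonneg)
qed

lemma Lp_cball_emp_measure:
  fixes z :: "'i \<Rightarrow> 'a::topological_space"
  assumes I: "finite I" "I \<noteq> {}" and C: "C \<in> borel_measurable borel" "g \<in> borel_measurable borel"
    and f: "f \<in> Lp_cball (emp_measure I z) 2 g (e * Lp_norm (emp_measure I z) 2 C)" and e: "e \<ge> 0"
  shows "(\<Sum>i\<in>I. (f (z i) - g (z i))\<^sup>2) \<le> e\<^sup>2 * (\<Sum>i\<in>I. (C (z i))\<^sup>2)"
proof -
  have "f \<in> borel_measurable borel" using f by (simp add: Lp_cball_def emp_measure_def)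
  then have "(\<lambda>x. f x - g x) \<in> borel_measurable borel" using C by simp
  then have "sqrt ((\<Sum>i\<in>I. (f (z i) - g (z i))\<^sup>2) / card I) \<le> e * sqrt ((\<Sum>i\<in>I. (C (z i))\<^sup>2) / card I)"
    using f I C by (simp add: Lp_cball_def Lp_norm_emp_measure)
  also have "\<dots> = sqrt ((e\<^sup>2 * (\<Sum>i\<in>I. (C (z i))\<^sup>2)) / card I)"
    using e by (simp add: real_sqrt_mult real_sqrt_divide)
  finally show ?thesis
    using I by (simp add: divide_le_cancel card_gt_0_iff)
qed

lemma sum_Icc_double:
  fixes f :: "nat \<Rightarrow> real"
  shows "(\<Sum>i\<in>{1..2*n}. f i) = (\<Sum>j\<in>{1..n}. f j + f (n + j))"
proof -
  have "{1..2*n} = {1..n} \<union> {n+1..n+n}" by auto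
  then have "(\<Sum>i\<in>{1..2*n}. f i) = (\<Sum>i\<in>{1..n}. f i) + (\<Sum>i\<in>{n+1..n+n}. f i)"
    by (simp add: sum.union_disjoint)
  also have "(\<Sum>i\<in>{n+1..n+n}. f i) = (\<Sum>j\<in>{1..n}. f (n + j))"
    using sum.shift_bounds_cl_nat_ivl[of f 1 n n] by (simp add: add.commute)
  finally show ?thesis by (simp add: sum.distrib)
qed

lemma sum_power2_diff_le:
  fixes a b :: "'i \<Rightarrow> real"
  shows "(\<Sum>j\<in>I. (a j - b j)\<^sup>2) \<le> 2 * (\<Sum>j\<in>I. (a j)\<^sup>2 + (b j)\<^sup>2)"
  unfolding sum_distrib_left
proof (rule sum_mono)
  fix j
  have "0 \<le> (a j + b j)\<^sup>2" by simp
  then show "(a j - b j)\<^sup>2 \<le> 2 * ((a j)\<^sup>2 + (b j)\<^sup>2)" by (simp add: power2_eq_square algebra_simps)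
qed

text \<open>The data \<open>z\<close> are fixed and only the signs vary; \<open>ennreal\<close> of a
  difference is its positive part, hence the excess over the level. The nets are taken for the
  empirical measure of all 2 n points. By (a - b)^2 \<le> 2 (a^2 + b^2), the bound 4 n \<tau>^2 for
  the envelope turns a relative radius r into a squared increment of at most 8 (L r)^2.\<close>

lemma symmetrized_process_excess:
  fixes F :: "('a::t1_space \<Rightarrow> real) set" and z :: "nat \<Rightarrow> 'a"
  assumes n: "n \<ge> 1" and F: "F \<noteq> {}" "\<And>f. f \<in> F \<Longrightarrow> f \<in> borel_measurable borel"
      "\<And>f x. f \<in> F \<Longrightarrow> \<bar>f x\<bar> \<le> C x"
    and C: "C \<in> borel_measurable borel"
    and J: "J_integral F C (1/4) < \<infinity>" and s: "s \<ge> 0" and \<tau>: "\<tau> > 0"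
    and z: "(\<Sum>i\<in>{1..2*n}. (C (z i))\<^sup>2) \<le> 4 * real n * \<tau>\<^sup>2"
  shows "(\<Sum>\<sigma>\<in>Pow {1..n}. SUP f\<in>F. ennreal (\<bar>\<Sum>j\<in>{1..n}. rsign \<sigma> j * (f (z j) - f (z (n + j)))\<bar>
        / (sqrt n * \<tau>) - (36 * enn2real (J_integral F C (1/4)) + 3/40 * s)))
    \<le> 2 ^ n * ennreal (exp (- (3/100) * s) / 2)"
proof -
  define L where "L = sqrt n * \<tau>"
  have L: "L > 0" "L\<^sup>2 = n * \<tau>\<^sup>2" using n \<tau> by (auto simp: L_def power_mult_distrib)
  define Q where "Q = emp_measure {1..2*n} z"
  define r :: "nat \<Rightarrow> real" where "r k = (1/2) ^ (2 + k)" for k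
  have r: "r k > 0" "r k \<le> 1/4" for k by (auto simp: r_def power_le_one)
  define h where "h k = enn2real (sup_entropy F C (r k))" for k
  define Jr where "Jr = enn2real (J_integral F C (1/4))"
  have fin: "sup_entropy F C (r k) < \<infinity>" for k by (rule sup_entropy_finite[OF J r])
  have hr: "sup_entropy F C (r k) = ennreal (h k)" and h0: "h k \<ge> 0" for k
    using fin[of k] by (auto simp: h_def)
  have Jr: "J_integral F C (1/4) = ennreal Jr" "Jr \<ge> 0" using J by (auto simp: Jr_def)
  have Q: "Q \<in> M_fin" unfolding Q_def using n by (intro emp_measure_in_M_fin) auto
  have "\<exists>T. finite T \<and> T \<subseteq> F \<and> F \<subseteq> (\<Union>g\<in>T. Lp_cball Q 2 g (r k * Lp_norm Q 2 C)) \<and>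
    2 * real (card T) \<le> exp ((h k)\<^sup>2) \<and> (h k)\<^sup>2 \<ge> ln 2" for k
    using net_exists[OF fin[of k] Q F(1)] unfolding h_def by metis
  then obtain T where T: "\<And>k. finite (T k)" "\<And>k. T k \<subseteq> F"
    "\<And>k. F \<subseteq> (\<Union>g\<in>T k. Lp_cball Q 2 g (r k * Lp_norm Q 2 C))"
    "\<And>k. 2 * real (card (T k)) \<le> exp ((h k)\<^sup>2)" "\<And>k. (h k)\<^sup>2 \<ge> ln 2"
    by metis
  have "\<forall>k. \<forall>f\<in>F. \<exists>g\<in>T k. f \<in> Lp_cball Q 2 g (r k * Lp_norm Q 2 C)" using T(3) by blast
  then obtain \<pi> where \<pi>: "\<And>k f. f \<in> F \<Longrightarrow> \<pi> k f \<in> T k"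
    "\<And>k f. f \<in> F \<Longrightarrow> f \<in> Lp_cball Q 2 (\<pi> k f) (r k * Lp_norm Q 2 C)"
    by metis
  have h2: "(h k)\<^sup>2 \<ge> 2/3" for k using T(5)[of k] ln2_ge_two_thirds by linarith
  have h: "h k \<ge> 4/5" for k
    by (rule power2_le_imp_le) (use h2[of k] h0 in \<open>auto simp: power_divide\<close>)
  define A where "A f j = f (z j) - f (z (n + j))" for f :: "'a \<Rightarrow> real" and j
  have A: "(\<Sum>j\<in>{1..n}. (A f j)\<^sup>2) \<le> 8 * L\<^sup>2" if "f \<in> F" for f
  proof -
    have "(\<Sum>j\<in>{1..n}. (A f j)\<^sup>2) \<le> 2 * (\<Sum>i\<in>{1..2*n}. (f (z i))\<^sup>2)"
      unfolding A_def sum_Icc_double by (rule sum_power2_diff_le)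
    also have "\<dots> \<le> 2 * (\<Sum>i\<in>{1..2*n}. (C (z i))\<^sup>2)"
      using F(3)[OF that] by (intro mult_left_mono sum_mono) (auto intro: abs_le_square_iff[THEN iffD1] order_trans[OF _ abs_ge_self])
    finally show ?thesis using z L by simp
  qed
  have A\<pi>: "(\<Sum>j\<in>{1..n}. (A f j - A (\<pi> k f) j)\<^sup>2) \<le> 8 * (L * (1/2) ^ (2 + k))\<^sup>2" if "f \<in> F" for f k
  proof -
    let ?g = "\<pi> k f"
    have "?g \<in> borel_measurable borel" using \<pi>(1)[OF that] T(2) F(2) by blast
    have "(\<Sum>j\<in>{1..n}. (A f j - A ?g j)\<^sup>2)
        = (\<Sum>j\<in>{1..n}. ((f (z j) - ?g (z j)) - (f (z (n + j)) - ?g (z (n + j))))\<^sup>2)"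
      by (simp add: A_def algebra_simps)
    also have "\<dots> \<le> 2 * (\<Sum>i\<in>{1..2*n}. (f (z i) - ?g (z i))\<^sup>2)"
      unfolding sum_Icc_double by (rule sum_power2_diff_le)
    also have "\<dots> \<le> 2 * ((r k)\<^sup>2 * (\<Sum>i\<in>{1..2*n}. (C (z i))\<^sup>2))"
      using \<pi>(2)[OF that, of k] n C \<open>?g \<in> _\<close> r[of k] unfolding Q_def
      by (intro mult_left_mono Lp_cball_emp_measure) auto
    also have "\<dots> \<le> 2 * ((r k)\<^sup>2 * (4 * L\<^sup>2))"
      using z L by (intro mult_left_mono) auto
    also have "\<dots> = 8 * (L * (1/2) ^ (2 + k))\<^sup>2"
      unfolding r_def power_mult_distrib[of L] by simp
    finally show ?thesis .
  qed
  \<comment> \<open>The step sum says h 0 / 8 + (sum of r k * h (Suc k)) / 4 \<le> J. Multiplied by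
    24 it covers all links and half of the root term 6 h 0; the other half 3 h 0 is at most 12 J.
    The terms in s give s/20 * (1 + 1/2) = 3/40 s.\<close>
  have x: "6 * h 0 + s / 20 + (\<Sum>k<K. (1/2) ^ (2 + k) * (6 * h (Suc k) + s / 20)) \<le> 36 * Jr + 3/40 * s" for K
  proof -
    have "(\<Sum>k<K. r k) = 1/2 - (1/2) ^ Suc K" by (induction K) (auto simp: r_def)
    then have rsum: "(\<Sum>k<K. r k) \<le> 1/2" by simp
    have "ennreal (\<Sum>k<Suc K. (r k - r (Suc k)) * h k)
        = (\<Sum>k<Suc K. ennreal (r k - r (Suc k)) * sup_entropy F C (r k))"
    proof -
      have "r k - r (Suc k) \<ge> 0" for k by (simp add: r_def)
      then show ?thesis unfolding hr using h0
        by (subst sum_ennreal[symmetric]) (auto simp: ennreal_mult'' intro!: sum.cong)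
    qed
    also have "\<dots> \<le> J_integral F C (r 0)"
      using r by (intro J_integral_ge_step) (auto simp: decseq_Suc_iff r_def)
    also have "r 0 = 1/4" by (simp add: r_def power2_eq_square)
    finally have "(\<Sum>k<Suc K. (r k - r (Suc k)) * h k) \<le> Jr" using Jr by simp
    moreover have "(\<Sum>k<Suc K. (r k - r (Suc k)) * h k) = h 0 / 8 + (\<Sum>k<K. r k * h (Suc k)) / 4"
      unfolding sum.lessThan_Suc_shift by (simp add: r_def power2_eq_square power3_eq_cube sum_divide_distrib)
    moreover have "h 0 / 4 \<le> Jr"
    proof -
      have "ennreal (1/4) * sup_entropy F C (1/4) \<le> J_integral F C (1/4)"
        by (rule J_integral_ge_entropy) simp
      moreover have "sup_entropy F C (1/4) = ennreal (h 0)"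
        using hr[of 0] by (simp add: r_def power2_eq_square)
      ultimately show ?thesis using Jr h0[of 0] by (simp flip: ennreal_mult)
    qed
    moreover have "(\<Sum>k<K. (1/2) ^ (2 + k) * (6 * h (Suc k) + s / 20))
        = 6 * (\<Sum>k<K. r k * h (Suc k)) + s / 20 * (\<Sum>k<K. r k)"
      unfolding sum_distrib_left sum.distrib[symmetric] by (intro sum.cong) (auto simp: r_def algebra_simps)
    moreover have "s / 20 * (\<Sum>k<K. r k) \<le> s / 20 * (1/2)" using rsum s by (intro mult_left_mono) auto
    ultimately show ?thesis by linarith
  qed
  define c where "c = 36 * Jr + 3/40 * s"
  let ?S = "\<lambda>\<sigma>. SUP f\<in>F. ennreal (\<bar>\<Sum>j\<in>{1..n}. rsign \<sigma> j * A f j\<bar> / L - c)"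
  have "(\<Sum>\<sigma>\<in>Pow {1..n}. ?S \<sigma>) \<le> ennreal (2 ^ n * (exp (- (3/100) * s) / 2)) + ennreal e" if e: "e > 0" for e
  proof -
    \<comment> \<open>Scaled so that the chaining remainder amounts to \<open>e\<close> after
      summation over the 2^n sign patterns and division by \<open>L\<close>.\<close>
    have pos: "L * (e / 2 ^ n) > 0" using L e by simp
    obtain W where W: "\<And>\<sigma>. W \<sigma> \<ge> 0"
      "\<And>\<sigma> f. f \<in> F \<Longrightarrow> \<bar>\<Sum>j\<in>{1..n}. rsign \<sigma> j * A f j\<bar> \<le> L * c + W \<sigma>"
      "(\<Sum>\<sigma>\<in>Pow {1..n}. W \<sigma>) \<le> 2 ^ card {1..n} * (L * (exp (- (3/100) * s) / 2) + L * (e / 2 ^ n))"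
      by (rule rademacher_chaining[OF finite_atLeastAtMost L(1) s pos T(1,2) \<pi>(1) A A\<pi> T(4) h h2 x[folded c_def]])
        (assumption | rule that)+
    have "?S \<sigma> \<le> ennreal (W \<sigma> / L)" for \<sigma>
    proof (rule SUP_least)
      fix f assume "f \<in> F"
      then have "\<bar>\<Sum>j\<in>{1..n}. rsign \<sigma> j * A f j\<bar> / L \<le> (L * c + W \<sigma>) / L"
        using W(2) L by (intro divide_right_mono) auto
      then show "ennreal (\<bar>\<Sum>j\<in>{1..n}. rsign \<sigma> j * A f j\<bar> / L - c) \<le> ennreal (W \<sigma> / L)"
        using L by (intro ennreal_leI) (simp add: add_divide_distrib)
    qed
    then have "(\<Sum>\<sigma>\<in>Pow {1..n}. ?S \<sigma>) \<le> (\<Sum>\<sigma>\<in>Pow {1..n}. ennreal (W \<sigma> / L))"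
      by (rule sum_mono)
    also have "\<dots> = ennreal ((\<Sum>\<sigma>\<in>Pow {1..n}. W \<sigma>) / L)"
      using W(1) L by (simp add: sum_ennreal sum_divide_distrib)
    also have "\<dots> \<le> ennreal (2 ^ n * (exp (- (3/100) * s) / 2) + e)"
    proof (rule ennreal_leI)
      have "(\<Sum>\<sigma>\<in>Pow {1..n}. W \<sigma>) \<le> (2 ^ n * (exp (- (3/100) * s) / 2) + e) * L"
        using W(3) by (simp add: algebra_simps)
      then show "(\<Sum>\<sigma>\<in>Pow {1..n}. W \<sigma>) / L \<le> 2 ^ n * (exp (- (3/100) * s) / 2) + e"
        using L(1) by (simp only: pos_divide_le_eq)
    qed
    also have "\<dots> = ennreal (2 ^ n * (exp (- (3/100) * s) / 2)) + ennreal e"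
      using e by (intro ennreal_plus) auto
    finally show ?thesis .
  qed
  then have "(\<Sum>\<sigma>\<in>Pow {1..n}. ?S \<sigma>) \<le> ennreal (2 ^ n * (exp (- (3/100) * s) / 2))"
    by (rule ennreal_le_epsilon)
  also have "\<dots> = 2 ^ n * ennreal (exp (- (3/100) * s) / 2)"
    by (subst ennreal_mult) (auto simp flip: ennreal_power)
  finally show ?thesis by (simp only: A_def L_def c_def Jr_def)
qed

section \<open>Symmetrization and the ghost sample\<close>

text \<open>Random signs realized as permutations: for \<sigma> inside {1..n} this is the involution
  exchanging i and n + i for i in \<sigma>, and it multiplies the difference of the two halves at j
  by \<open>rsign \<sigma> j\<close>.\<close>

definition swap_halves :: "nat \<Rightarrow> nat set \<Rightarrow> nat \<Rightarrow> nat" where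
  "swap_halves n \<sigma> i = (if i \<in> \<sigma> then n + i else if n < i \<and> i - n \<in> \<sigma> then i - n else i)"

lemma bij_betw_swap_halves:
  assumes "\<sigma> \<subseteq> {1..n}"
  shows "bij_betw (swap_halves n \<sigma>) {1..2*n} {1..2*n}"
proof (rule bij_betwI)
  have *: "\<sigma> \<subseteq> {i. 1 \<le> i \<and> i \<le> n}" using assms by auto
  show m: "swap_halves n \<sigma> \<in> {1..2*n} \<rightarrow> {1..2*n}"
    using * by (fastforce simp: swap_halves_def)
  then show "swap_halves n \<sigma> \<in> {1..2*n} \<rightarrow> {1..2*n}" .
  show inv: "swap_halves n \<sigma> (swap_halves n \<sigma> i) = i" if "i \<in> {1..2*n}" for i
    using * that by (fastforce simp: swap_halves_def)
  then show "swap_halves n \<sigma> (swap_halves n \<sigma> i) = i" if "i \<in> {1..2*n}" for i using that .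
qed

lemma diff_swap_halves:
  fixes f :: "nat \<Rightarrow> real"
  assumes "\<sigma> \<subseteq> {1..n}" "j \<in> {1..n}"
  shows "f (swap_halves n \<sigma> j) - f (swap_halves n \<sigma> (n + j)) = rsign \<sigma> j * (f j - f (n + j))"
proof -
  have "n + j \<notin> \<sigma>" using assms by auto
  then show ?thesis using assms by (auto simp: swap_halves_def rsign_def)
qed

lemma nn_integral_PiM_permute:
  assumes P: "prob_space P" and p: "bij_betw p I I"
    and [measurable]: "\<Psi> \<in> borel_measurable (Pi\<^sub>M I (\<lambda>_. P))"
  shows "(\<integral>\<^sup>+z. \<Psi> (\<lambda>i\<in>I. z (p i)) \<partial>Pi\<^sub>M I (\<lambda>_. P)) = (\<integral>\<^sup>+z. \<Psi> z \<partial>Pi\<^sub>M I (\<lambda>_. P))"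
proof -
  have m: "(\<lambda>z. \<lambda>i\<in>I. z (p i)) \<in> measurable (Pi\<^sub>M I (\<lambda>_. P)) (Pi\<^sub>M I (\<lambda>_. P))"
    using p by (intro measurable_restrict measurable_component_singleton) (auto simp: bij_betw_def)
  have "distr (Pi\<^sub>M I (\<lambda>_. P)) (Pi\<^sub>M I (\<lambda>_. P)) (\<lambda>z. \<lambda>i\<in>I. z (p i)) = Pi\<^sub>M I (\<lambda>_. P)"
    using distr_PiM_reindex[of I "\<lambda>_. P" p I] P p by (auto simp: bij_betw_def)
  then show ?thesis using nn_integral_distr[OF m, of \<Psi>] by simp
qed

text \<open>Every swap preserves the product measure, so the integral equals that of the average
  over all 2^n swaps, and a pointwise bound on this average is enough. The signs never have to
  become random variables.\<close>

lemma nn_integral_symmetrize: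
  assumes P: "prob_space P" and [measurable]: "\<Psi> \<in> borel_measurable (Pi\<^sub>M {1..2*n} (\<lambda>_. P))"
    and q: "\<And>z. z \<in> space (Pi\<^sub>M {1..2*n} (\<lambda>_. P)) \<Longrightarrow>
      (\<Sum>\<sigma>\<in>Pow {1..n}. \<Psi> (\<lambda>i\<in>{1..2*n}. z (swap_halves n \<sigma> i))) \<le> 2 ^ n * q"
  shows "(\<integral>\<^sup>+z. \<Psi> z \<partial>Pi\<^sub>M {1..2*n} (\<lambda>_. P)) \<le> q"
proof -
  let ?\<mu> = "Pi\<^sub>M {1..2*n} (\<lambda>_. P)"
  interpret \<mu>: prob_space ?\<mu> using P by (intro prob_space_PiM)
  have [measurable]: "(\<lambda>z. \<Psi> (\<lambda>i\<in>{1..2*n}. z (swap_halves n \<sigma> i))) \<in> borel_measurable ?\<mu>"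
    if "\<sigma> \<in> Pow {1..n}" for \<sigma>
  proof -
    have "(\<lambda>z. \<lambda>i\<in>{1..2*n}. z (swap_halves n \<sigma> i)) \<in> measurable ?\<mu> ?\<mu>"
      using bij_betw_swap_halves[of \<sigma> n] that
      by (intro measurable_restrict measurable_component_singleton) (auto simp: bij_betw_def)
    then show ?thesis by (rule measurable_compose) measurable
  qed
  have "2 ^ n * (\<integral>\<^sup>+z. \<Psi> z \<partial>?\<mu>) = (\<Sum>\<sigma>\<in>Pow {1..n}. \<integral>\<^sup>+z. \<Psi> z \<partial>?\<mu>)"
    by (simp add: card_Pow)
  also have "\<dots> = (\<Sum>\<sigma>\<in>Pow {1..n}. \<integral>\<^sup>+z. \<Psi> (\<lambda>i\<in>{1..2*n}. z (swap_halves n \<sigma> i)) \<partial>?\<mu>)"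
    using P by (intro sum.cong nn_integral_PiM_permute[symmetric] bij_betw_swap_halves assms(2)) auto
  also have "\<dots> = (\<integral>\<^sup>+z. (\<Sum>\<sigma>\<in>Pow {1..n}. \<Psi> (\<lambda>i\<in>{1..2*n}. z (swap_halves n \<sigma> i))) \<partial>?\<mu>)"
    by (rule nn_integral_sum[symmetric]) measurable
  also have "\<dots> \<le> (\<integral>\<^sup>+z. 2 ^ n * q \<partial>?\<mu>)" by (intro nn_integral_mono q)
  also have "\<dots> = 2 ^ n * q" using \<mu>.emeasure_space_1 by simp
  finally have "2 ^ n * (\<integral>\<^sup>+z. \<Psi> z \<partial>?\<mu>) \<le> 2 ^ n * q" .
  moreover have "(2 ^ n :: ennreal) = ennreal (2 ^ n)" by (simp flip: ennreal_power)
  ultimately show ?thesis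
    by (metis ennreal_mult_le_mult_iff ennreal_neq_top ennreal_eq_0_iff not_le zero_less_power zero_less_numeral)
qed

section \<open>Moments under the product measure and the conditioned ghost sample\<close>

lemma integral_le_nn_integral:
  fixes f :: "'a \<Rightarrow> real"
  assumes "integrable M f"
  shows "ennreal (integral\<^sup>L M f) \<le> (\<integral>\<^sup>+x. ennreal (f x) \<partial>M)"
proof -
  have "ennreal (integral\<^sup>L M f) \<le> ennreal (LINT x|M. max 0 (f x))"
    using assms by (intro ennreal_leI integral_mono) auto
  also have "\<dots> = (\<integral>\<^sup>+x. ennreal (max 0 (f x)) \<partial>M)"
    using assms by (intro nn_integral_eq_integral[symmetric]) auto
  finally show ?thesis by simp
qed

lemma PiM_component_moments:
  fixes f :: "'a \<Rightarrow> real"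
  assumes P: "prob_space P" and i: "i \<in> J"
    and f: "integrable P f"
  shows "integrable (Pi\<^sub>M J (\<lambda>_. P)) (\<lambda>w. f (w i))" "(LINT w|Pi\<^sub>M J (\<lambda>_. P). f (w i)) = (LINT x|P. f x)"
proof -
  have d: "distr (Pi\<^sub>M J (\<lambda>_. P)) P (\<lambda>w. w i) = P" using distr_PiM_component[of J "\<lambda>_. P" i] P i by simp
  have m: "(\<lambda>w. w i) \<in> measurable (Pi\<^sub>M J (\<lambda>_. P)) P" using i by (rule measurable_component_singleton)
  have fm: "f \<in> borel_measurable P" using f by simp
  show "integrable (Pi\<^sub>M J (\<lambda>_. P)) (\<lambda>w. f (w i))"
    using integrable_distr_eq[OF m fm] f d by simp
  show "(LINT w|Pi\<^sub>M J (\<lambda>_. P). f (w i)) = (LINT x|P. f x)"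
    using integral_distr[OF m fm] d by simp
qed

lemma PiM_second_moment:
  fixes g :: "'a \<Rightarrow> real"
  assumes P: "prob_space P" and J: "finite J" and g: "integrable P g" "integrable P (\<lambda>x. (g x)\<^sup>2)" "(LINT x|P. g x) = 0"
  shows "integrable (Pi\<^sub>M J (\<lambda>_. P)) (\<lambda>w. (\<Sum>j\<in>J. g (w j))\<^sup>2)"
    and "(LINT w|Pi\<^sub>M J (\<lambda>_. P). (\<Sum>j\<in>J. g (w j))\<^sup>2) = real (card J) * (LINT x|P. (g x)\<^sup>2)"
proof -
  interpret P: prob_space P by (rule P)
  interpret product_sigma_finite "\<lambda>_. P" by unfold_locales
  let ?\<mu> = "Pi\<^sub>M J (\<lambda>_. P)"
  have prod: "integrable ?\<mu> (\<lambda>w. g (w i) * g (w j)) \<and>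
    (LINT w|?\<mu>. g (w i) * g (w j)) = (if i = j then LINT x|P. (g x)\<^sup>2 else 0)"
    if ij: "i \<in> J" "j \<in> J" for i j
  proof (cases "i = j")
    case True
    then show ?thesis using PiM_component_moments[OF P ij(1) g(2)] by (simp add: power2_eq_square)
  next
    case False
    \<comment> \<open>Padding with the constant 1 turns a product of two coordinates into a product
      over all of \<open>J\<close>, whose integral factorizes; the factor at \<open>i\<close> has
      mean 0.\<close>
    define f where "f k = (if k = i \<or> k = j then g else (\<lambda>_. 1))" for k
    have "(\<Prod>k\<in>J. f k (w k)) = (\<Prod>k\<in>{i, j}. f k (w k))" for w
      using J ij by (intro prod.mono_neutral_right) (auto simp: f_def)
    then have p: "(\<Prod>k\<in>J. f k (w k)) = g (w i) * g (w j)" for w using False by (simp add: f_def)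
    have f: "integrable P (f k)" for k using g by (auto simp: f_def)
    have "(\<Prod>k\<in>J. LINT x|P. f k x) = 0"
      using J ij g(3) by (intro prod_zero) (auto simp: f_def intro!: bexI[of _ i])
    then show ?thesis
      using product_integrable_prod[of J f] product_integral_prod[of J f] J f False
      by (simp add: p)
  qed
  have eq: "(\<Sum>j\<in>J. g (w j))\<^sup>2 = (\<Sum>i\<in>J. \<Sum>j\<in>J. g (w i) * g (w j))" for w
    by (simp add: power2_eq_square sum_product)
  show "integrable ?\<mu> (\<lambda>w. (\<Sum>j\<in>J. g (w j))\<^sup>2)"
    unfolding eq using prod by (intro Bochner_Integration.integrable_sum) auto
  have "(LINT w|?\<mu>. (\<Sum>j\<in>J. g (w j))\<^sup>2) = (\<Sum>i\<in>J. \<Sum>j\<in>J. (LINT w|?\<mu>. g (w i) * g (w j)))"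
    unfolding eq using prod by (simp add: Bochner_Integration.integral_sum Bochner_Integration.integrable_sum)
  also have "\<dots> = (\<Sum>i\<in>J. \<Sum>j\<in>J. if i = j then LINT x|P. (g x)\<^sup>2 else 0)"
    using prod by (intro sum.cong) auto
  also have "\<dots> = real (card J) * (LINT x|P. (g x)\<^sup>2)" using J by simp
  finally show "(LINT w|?\<mu>. (\<Sum>j\<in>J. g (w j))\<^sup>2) = real (card J) * (LINT x|P. (g x)\<^sup>2)" .
qed

text \<open>Markov's inequality at twice the mean; the factor 2 in \<open>B_event\<close> is used
  here.\<close>

lemma PiM_ghost_probability:
  fixes C :: "'a \<Rightarrow> real"
  assumes P: "prob_space P" and J: "finite J" "J \<noteq> {}" and C: "integrable P (\<lambda>x. (C x)\<^sup>2)"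
    and [measurable]: "C \<in> borel_measurable P"
    and \<tau>: "(LINT x|P. (C x)\<^sup>2) = \<tau>\<^sup>2" "\<tau> > 0"
  shows "measure (Pi\<^sub>M J (\<lambda>_. P)) {w\<in>space (Pi\<^sub>M J (\<lambda>_. P)). (\<Sum>j\<in>J. (C (w j))\<^sup>2) \<le> 2 * real (card J) * \<tau>\<^sup>2} \<ge> 1/2"
proof -
  let ?\<mu> = "Pi\<^sub>M J (\<lambda>_. P)" and ?X = "\<lambda>w. \<Sum>j\<in>J. (C (w j))\<^sup>2" and ?t = "2 * real (card J) * \<tau>\<^sup>2"
  interpret \<mu>: prob_space ?\<mu> using P by (intro prob_space_PiM)
  have t: "?t > 0" using J \<tau> by (simp add: card_gt_0_iff)
  have int: "integrable ?\<mu> ?X"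
    using PiM_component_moments(1)[OF P _ C] by (intro Bochner_Integration.integrable_sum)
  have "(LINT w|?\<mu>. ?X w) = (\<Sum>j\<in>J. LINT w|?\<mu>. (C (w j))\<^sup>2)"
    using PiM_component_moments(1)[OF P _ C] by (intro Bochner_Integration.integral_sum)
  also have "\<dots> = real (card J) * \<tau>\<^sup>2"
    using PiM_component_moments(2)[OF P _ C, of _ J] \<tau> by simp
  finally have E: "(LINT w|?\<mu>. ?X w) = ?t / 2" by simp
  have "measure ?\<mu> {w\<in>space ?\<mu>. ?t \<le> ?X w} \<le> (LINT w|?\<mu>. ?X w) / ?t"
    by (rule integral_Markov_inequality_measure[OF int]) (use t in \<open>auto intro!: AE_I2 sum_nonneg\<close>)
  also have "\<dots> = 1/2" unfolding E using t by (auto simp: zero_less_mult_iff)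
  finally have m: "measure ?\<mu> {w\<in>space ?\<mu>. ?t \<le> ?X w} \<le> 1/2" .
  have [measurable]: "?X \<in> borel_measurable ?\<mu>" using int by simp
  have "1 = measure ?\<mu> (space ?\<mu>)" by (simp add: \<mu>.prob_space)
  also have "\<dots> \<le> measure ?\<mu> ({w\<in>space ?\<mu>. ?X w \<le> ?t} \<union> {w\<in>space ?\<mu>. ?t \<le> ?X w})"
    by (intro \<mu>.finite_measure_mono) auto
  also have "\<dots> \<le> measure ?\<mu> {w\<in>space ?\<mu>. ?X w \<le> ?t} + measure ?\<mu> {w\<in>space ?\<mu>. ?t \<le> ?X w}"
    by (rule measure_Un_le) measurable
  finally show ?thesis using m by linarith
qed

lemma PiM_ghost_excess:
  fixes f C :: "'a \<Rightarrow> real"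
  assumes P: "prob_space P" and J: "finite J" "J \<noteq> {}" and C: "integrable P (\<lambda>x. (C x)\<^sup>2)"
    and Cm[measurable]: "C \<in> borel_measurable P" and fm[measurable]: "f \<in> borel_measurable P"
    and f: "\<And>x. \<bar>f x\<bar> \<le> C x" "integrable P f"
    and \<tau>: "(LINT x|P. (C x)\<^sup>2) = \<tau>\<^sup>2" "\<tau> > 0"
    and a: "\<bar>a - real (card J) * (LINT x|P. f x)\<bar> / (sqrt (card J) * \<tau>) \<ge> b" "b \<ge> 1 + c"
  shows "ennreal ((b - 1 - c) / 2) \<le> (\<integral>\<^sup>+w. ennreal (\<bar>a - (\<Sum>j\<in>J. f (w j))\<bar> / (sqrt (card J) * \<tau>) - c)
      * indicator {w\<in>space (Pi\<^sub>M J (\<lambda>_. P)). (\<Sum>j\<in>J. (C (w j))\<^sup>2) \<le> 2 * real (card J) * \<tau>\<^sup>2} w \<partial>Pi\<^sub>M J (\<lambda>_. P))"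
proof -
  interpret P: prob_space P by (rule P)
  let ?\<mu> = "Pi\<^sub>M J (\<lambda>_. P)"
  interpret \<mu>: prob_space ?\<mu> using P by (intro prob_space_PiM)
  define S where "S = {w\<in>space ?\<mu>. (\<Sum>j\<in>J. (C (w j))\<^sup>2) \<le> 2 * real (card J) * \<tau>\<^sup>2}"
  have S[measurable]: "S \<in> sets ?\<mu>" unfolding S_def by measurable
  define p where "p = measure ?\<mu> S"
  have p: "p \<ge> 1/2" unfolding p_def S_def by (rule PiM_ghost_probability[OF P J C Cm \<tau>])
  define L where "L = sqrt (card J) * \<tau>"
  have L: "L > 0" "L\<^sup>2 = real (card J) * \<tau>\<^sup>2"
    using J \<tau> by (auto simp: L_def power_mult_distrib card_gt_0_iff)
  define m where "m = (LINT x|P. f x)"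
  define g where "g x = f x - m" for x
  have f2: "integrable P (\<lambda>x. (f x)\<^sup>2)"
    using C by (rule Bochner_Integration.integrable_bound)
      (auto intro!: AE_I2 abs_le_square_iff[THEN iffD1] order_trans[OF f(1) abs_ge_self])
  have g: "integrable P g" "(LINT x|P. g x) = 0"
    unfolding g_def[abs_def] using f(2) by (auto simp: m_def P.prob_space)
  have g2_eq: "(g x)\<^sup>2 = (f x)\<^sup>2 - 2 * m * f x + m\<^sup>2" for x
    by (simp add: g_def power2_eq_square algebra_simps)
  have g2: "integrable P (\<lambda>x. (g x)\<^sup>2)"
    unfolding g2_eq using f(2) f2 by auto
  have "(LINT x|P. (g x)\<^sup>2) = (LINT x|P. (f x)\<^sup>2) - m\<^sup>2"
    unfolding g2_eq using f(2) f2 by (simp add: P.prob_space m_def[symmetric] power2_eq_square)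
  also have "\<dots> \<le> (LINT x|P. (f x)\<^sup>2)" by simp
  also have "\<dots> \<le> \<tau>\<^sup>2" unfolding \<tau>(1)[symmetric] using C f2
    by (intro integral_mono) (auto intro!: abs_le_square_iff[THEN iffD1] order_trans[OF f(1) abs_ge_self])
  finally have var: "(LINT x|P. (g x)\<^sup>2) \<le> \<tau>\<^sup>2" .
  define D where "D w = (\<Sum>j\<in>J. g (w j)) / L" for w
  have D_eq: "(\<Sum>j\<in>J. f (w j)) = real (card J) * m + L * D w" for w
    using L by (simp add: D_def g_def sum_subtractf)
  have D: "integrable ?\<mu> D"
    unfolding D_def using PiM_component_moments(1)[OF P _ g(1), of _ J]
    by (intro Bochner_Integration.integrable_divide Bochner_Integration.integrable_sum) auto
  have D0: "(LINT w|?\<mu>. D w) = 0"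
  proof -
    have "(LINT w|?\<mu>. D w) = (\<Sum>j\<in>J. LINT w|?\<mu>. g (w j)) / L"
      unfolding D_def Bochner_Integration.integral_divide_zero
      by (subst Bochner_Integration.integral_sum) (use PiM_component_moments(1)[OF P _ g(1), of _ J] in auto)
    also have "\<dots> = 0" using PiM_component_moments(2)[OF P _ g(1), of _ J] g(2) by simp
    finally show ?thesis .
  qed
  have D2: "integrable ?\<mu> (\<lambda>w. (D w)\<^sup>2)"
    unfolding D_def power_divide using PiM_second_moment(1)[OF P J(1) g(1) g2 g(2)] by simp
  have D2_le: "(LINT w|?\<mu>. (D w)\<^sup>2) \<le> 1"
    unfolding D_def power_divide using PiM_second_moment(2)[OF P J(1) g(1) g2 g(2)] var L J \<tau>
    by (simp add: card_gt_0_iff divide_le_eq)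
  have DS: "integrable ?\<mu> (\<lambda>w. D w * indicator S w)"
    using integrable_mult_indicator[OF S D] by (simp add: mult.commute)
  have IS: "integrable ?\<mu> (indicator S :: _ \<Rightarrow> real)"
    by (simp add: integrable_indicator_iff \<mu>.emeasure_eq_measure)
  \<comment> \<open>The ghost sample is biased by conditioning on S. Since u D has mean 0, replacing the
    indicator of S by its centred version makes Young's inequality sharp enough for p >= 1/2.\<close>
  have bias: "u * (LINT w|?\<mu>. D w * indicator S w) \<le> p" if u: "\<bar>u\<bar> = 1" for u :: real
  proof -
    have u2: "u * u = 1" using u by (metis abs_mult_self_eq mult.right_neutral)
    have "u * (LINT w|?\<mu>. D w * indicator S w) = (LINT w|?\<mu>. u * (D w * indicator S w) - u * p * D w)"
      using D DS D0 by simp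
    also have "\<dots> \<le> (LINT w|?\<mu>. (D w)\<^sup>2 / 4 + (indicator S w * (1 - 2 * p) + p\<^sup>2))"
    proof (rule integral_mono)
      fix w
      have "0 \<le> (u * D w / 2 - (indicator S w - p))\<^sup>2" by simp
      also have "\<dots> = (u * u) * (D w)\<^sup>2 / 4 - (u * (D w * indicator S w) - u * p * D w)
          + (indicator S w * indicator S w - 2 * p * indicator S w + p\<^sup>2)"
        by (simp add: power2_eq_square algebra_simps)
      finally show "u * (D w * indicator S w) - u * p * D w
          \<le> (D w)\<^sup>2 / 4 + (indicator S w * (1 - 2 * p) + p\<^sup>2)"
        by (cases "w \<in> S") (simp_all add: u2 algebra_simps)
    qed (use D DS D2 IS in auto)
    also have "\<dots> = (LINT w|?\<mu>. (D w)\<^sup>2) / 4 + (p * (1 - 2 * p) + p\<^sup>2)"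
      using D2 IS by (simp add: p_def \<mu>.prob_space)
    also have "\<dots> \<le> 1/4 + (p - p\<^sup>2)" using D2_le by (simp add: algebra_simps power2_eq_square)
    also have "\<dots> \<le> p"
    proof -
      have "(1/2)\<^sup>2 \<le> p\<^sup>2" using p by (intro power_mono) auto
      then show ?thesis by (simp add: power_divide)
    qed
    finally show ?thesis .
  qed
  define d where "d = (a - real (card J) * m) / L"
  \<comment> \<open>The sign of \<open>d\<close> is fixed before integration: u (d - D) is an affine
    minorant of |d - D|, so only the bias of \<open>D\<close> on \<open>S\<close> enters its
    integral.\<close>
  define u :: real where "u = (if d \<ge> 0 then 1 else - 1)"
  have u: "\<bar>u\<bar> = 1" "u * d = \<bar>d\<bar>" by (auto simp: u_def)
  have d: "\<bar>d\<bar> \<ge> b" using a(1) L by (simp add: d_def m_def L_def[symmetric])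
  have int: "integrable ?\<mu> (\<lambda>w. (u * (d - D w) - c) * indicator S w)"
    using integrable_mult_indicator[OF S, of "\<lambda>w. u * (d - D w) - c"] D by (simp add: mult.commute)
  have "(b - 1 - c) / 2 \<le> p * (b - 1 - c)" using p a(2) mult_right_mono[of "1/2" p "b - 1 - c"] by simp
  also have "\<dots> \<le> (\<bar>d\<bar> - c) * p - p"
    using d p mult_left_mono[of b "\<bar>d\<bar>" p] by (simp add: algebra_simps)
  also have "\<dots> \<le> (\<bar>d\<bar> - c) * p - u * (LINT w|?\<mu>. D w * indicator S w)" using bias[OF u(1)] by simp
  also have "\<dots> = (LINT w|?\<mu>. (\<bar>d\<bar> - c) * indicator S w - u * (D w * indicator S w))"
    using IS DS by (simp add: p_def)
  also have "\<dots> = (LINT w|?\<mu>. (u * (d - D w) - c) * indicator S w)"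
    by (intro arg_cong[where f="integral\<^sup>L _"]) (auto simp: u(2)[symmetric] algebra_simps)
  finally have "ennreal ((b - 1 - c) / 2) \<le> ennreal (LINT w|?\<mu>. (u * (d - D w) - c) * indicator S w)"
    by (rule ennreal_leI)
  \<comment> \<open>Jensen's inequality for the positive part, which \<open>ennreal\<close> now
    takes inside the integral.\<close>
  also have "\<dots> \<le> (\<integral>\<^sup>+w. ennreal ((u * (d - D w) - c) * indicator S w) \<partial>?\<mu>)"
    by (rule integral_le_nn_integral[OF int])
  also have "\<dots> \<le> (\<integral>\<^sup>+w. ennreal (\<bar>a - (\<Sum>j\<in>J. f (w j))\<bar> / L - c) * indicator S w \<partial>?\<mu>)"
  proof (rule nn_integral_mono)
    fix w
    have "\<bar>a - (\<Sum>j\<in>J. f (w j))\<bar> / L = \<bar>d - D w\<bar>"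
      unfolding D_eq d_def using L by (simp add: abs_divide[symmetric] field_simps flip: abs_mult)
    moreover have "u * (d - D w) \<le> \<bar>d - D w\<bar>" by (auto simp: u_def)
    ultimately show "ennreal ((u * (d - D w) - c) * indicator S w)
        \<le> ennreal (\<bar>a - (\<Sum>j\<in>J. f (w j))\<bar> / L - c) * indicator S w"
      by (auto simp: indicator_def intro: ennreal_leI)
  qed
  finally show ?thesis by (simp only: S_def L_def)
qed

section \<open>The uniform deviation inequality\<close>

text \<open>At scale 1/4 the entropy number is at least sqrt (ln 2) \<ge> 4/5, and monotonicity
  gives a rectangle of area 1/4 * 4/5. The bound absorbs the additive constants in
  \<open>uniform_deviation\<close>.\<close>

lemma J_integral_lower_bound:
  fixes F :: "('a::t1_space \<Rightarrow> real) set"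
  assumes "F \<noteq> {}" "J_integral F C (1/4) < \<infinity>"
  shows "1/5 \<le> enn2real (J_integral F C (1/4))"
proof -
  let ?h = "enn2real (sup_entropy F C (1/4))"
  have fin: "sup_entropy F C (1/4) < \<infinity>" using assms(2) by (rule sup_entropy_finite) auto
  \<comment> \<open>Any member of \<open>M_fin\<close> serves as a witness; this one is a Dirac
    measure.\<close>
  have "emp_measure {()} (\<lambda>_. undefined :: 'a) \<in> M_fin" by (rule emp_measure_in_M_fin) auto
  from net_exists[OF fin this assms(1)] have "ln 2 \<le> ?h\<^sup>2" by metis
  then have "(4/5)\<^sup>2 \<le> ?h\<^sup>2" using ln2_ge_two_thirds by (simp add: power_divide)
  then have h: "4/5 \<le> ?h" by (rule power2_le_imp_le) simp
  have "enn2real (ennreal (1/4) * sup_entropy F C (1/4)) \<le> enn2real (J_integral F C (1/4))"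
    using assms(2) by (intro enn2real_mono J_integral_ge_entropy) auto
  then have "1/4 * ?h \<le> enn2real (J_integral F C (1/4))" by (simp add: enn2real_mult)
  with h show ?thesis by linarith
qed

lemma deviation_event_sets:
  fixes C :: "'a \<Rightarrow> real" and F0 :: "('a \<Rightarrow> real) set"
  assumes "countable F0" "\<And>f. f \<in> F0 \<Longrightarrow> f \<in> borel_measurable P" and [measurable]: "C \<in> borel_measurable P"
  shows "{z \<in> space (Pi\<^sub>M I (\<lambda>_. P)). (\<exists>f\<in>F0. b < \<bar>(\<Sum>j\<in>I. f (z j)) - m f\<bar> / L)
      \<and> (\<Sum>j\<in>I. (C (z j))\<^sup>2) \<le> r} \<in> sets (Pi\<^sub>M I (\<lambda>_. P))"
proof -
  let ?\<mu> = "Pi\<^sub>M I (\<lambda>_. P)"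
  let ?A = "\<lambda>f. {z \<in> space ?\<mu>. b < \<bar>(\<Sum>j\<in>I. f (z j)) - m f\<bar> / L}"
    and ?B = "{z \<in> space ?\<mu>. (\<Sum>j\<in>I. (C (z j))\<^sup>2) \<le> r}"
  have "?A f \<in> sets ?\<mu>" if "f \<in> F0" for f
  proof -
    have [measurable]: "f \<in> borel_measurable P" using that by (rule assms(2))
    show ?thesis by measurable
  qed
  then have "(\<Union>f\<in>F0. ?A f) \<in> sets ?\<mu>" by (intro sets.countable_UN'' assms(1))
  moreover have "?B \<in> sets ?\<mu>" by measurable
  ultimately have "(\<Union>f\<in>F0. ?A f) \<inter> ?B \<in> sets ?\<mu>" by (rule sets.Int)
  also have "(\<Union>f\<in>F0. ?A f) \<inter> ?B = {z \<in> space ?\<mu>. (\<exists>f\<in>F0. b < \<bar>(\<Sum>j\<in>I. f (z j)) - m f\<bar> / L)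
      \<and> (\<Sum>j\<in>I. (C (z j))\<^sup>2) \<le> r}" by auto
  finally show ?thesis .
qed

text \<open>The class \<open>F\<close> carries the entropy and the countable \<open>F0\<close> the
  event. The level is lowered by 1/100 because the event asks for a single function, while a
  supremum reaching \<open>s\<close> need not be attained.\<close>

lemma uniform_deviation:
  fixes P :: "'a::t1_space measure" and F F0 :: "('a \<Rightarrow> real) set"
  assumes P: "prob_space P" and sets_P: "sets P = sets borel" and n: "n \<ge> 1"
    and F: "F \<noteq> {}" "\<And>f. f \<in> F \<Longrightarrow> f \<in> borel_measurable borel"
      "\<And>f x. f \<in> F \<Longrightarrow> \<bar>f x\<bar> \<le> C x"
    and C: "C \<in> borel_measurable borel" "integrable P (\<lambda>x. (C x)\<^sup>2)"
    and \<tau>: "(LINT x|P. (C x)\<^sup>2) = \<tau>\<^sup>2" "\<tau> > 0"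
    and J: "J_integral F C (1/4) < \<infinity>"
    and F0: "F0 \<subseteq> F" "countable F0"
    and s: "s \<ge> 1 + 32 * sqrt 2 * enn2real (J_integral F C (1/4))"
  shows "measure (Pi\<^sub>M {1..n} (\<lambda>_. P)) {z \<in> space (Pi\<^sub>M {1..n} (\<lambda>_. P)).
      (\<exists>f\<in>F0. s - 1/100 < \<bar>(\<Sum>j\<in>{1..n}. f (z j)) - real n * (LINT x|P. f x)\<bar> / (sqrt n * \<tau>))
      \<and> (\<Sum>j\<in>{1..n}. (C (z j))\<^sup>2) \<le> 2 * real n * \<tau>\<^sup>2} \<le> exp (- (3/100) * s)"
proof -
  interpret P: prob_space P by (rule P)
  interpret product_sigma_finite "\<lambda>_. P" by unfold_locales
  define I where "I = {1..n}"
  define I' where "I' = {n+1..n+n}"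
  have II': "I \<inter> I' = {}" "I \<union> I' = {1..2*n}" "finite I" "finite I'" "I' \<noteq> {}" "card I' = n"
    using n by (auto simp: I_def I'_def)
  let ?\<mu> = "Pi\<^sub>M {1..2*n} (\<lambda>_. P)" and ?\<mu>1 = "Pi\<^sub>M I (\<lambda>_. P)" and ?\<mu>2 = "Pi\<^sub>M I' (\<lambda>_. P)"
  interpret \<mu>1: prob_space ?\<mu>1 using P by (intro prob_space_PiM)
  define Jr where "Jr = enn2real (J_integral F C (1/4))"
  define c where "c = 36 * Jr + 3/40 * s"
  define L where "L = sqrt n * \<tau>"
  define b where "b = s - 1/100"
  have Jr: "Jr \<ge> 1/5" unfolding Jr_def by (rule J_integral_lower_bound[OF F(1) J])
  have sqrt2: "sqrt 2 \<ge> 707/500" by (rule real_le_rsqrt) (simp add: power_divide)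
  have "sqrt 2 * Jr \<ge> 707/500 * Jr" using sqrt2 Jr by (intro mult_right_mono) auto
  \<comment> \<open>From s \<ge> 1 + 45 J the margin b - 1 - c = 37/40 s - 36 J - 101/100 is at
    least 45/8 J - 17/200, which exceeds 1 as J \<ge> 1/5.\<close>
  then have s': "s \<ge> 1 + 45 * Jr" using s Jr unfolding Jr_def[symmetric] by linarith
  then have s0: "s \<ge> 0" and b: "b \<ge> 1 + c" "1/2 \<le> (b - 1 - c) / 2"
    using Jr by (auto simp: b_def c_def field_simps)
  have [measurable_cong]: "sets P = sets borel" by (rule sets_P)
  have [measurable]: "C \<in> borel_measurable P" using C(1) by measurable
  have Fm[measurable (raw)]: "f \<in> borel_measurable P" if "f \<in> F0" for f
    using F(2)[of f] F0(1) that measurable_cong_sets[OF sets_P refl, of borel] by auto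
  \<comment> \<open>The supremum over the countable \<open>F0\<close> keeps \<open>\<Psi>\<close>
    measurable; it is enlarged to \<open>F\<close> only after \<open>z\<close> has been
    fixed.\<close>
  define \<Psi> where "\<Psi> z = (SUP f\<in>F0. ennreal (\<bar>\<Sum>j\<in>{1..n}. f (z j) - f (z (n + j))\<bar> / L - c))
    * indicator {z\<in>space ?\<mu>. (\<Sum>i\<in>{1..2*n}. (C (z i))\<^sup>2) \<le> 4 * real n * \<tau>\<^sup>2} z" for z
  have \<Psi>_meas[measurable]: "\<Psi> \<in> borel_measurable ?\<mu>"
  proof -
    have "(\<lambda>z. ennreal (\<bar>\<Sum>j\<in>{1..n}. f (z j) - f (z (n + j))\<bar> / L - c)) \<in> borel_measurable ?\<mu>"
      if "f \<in> F0" for f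
    proof -
      have *[measurable]: "f \<in> borel_measurable P" using that by (rule Fm)
      have "(\<lambda>z. f (z i)) \<in> borel_measurable ?\<mu>" if "i \<in> {1..2*n}" for i
        using that by measurable
      then show ?thesis
        by (intro measurable_compose[OF _ measurable_ennreal] borel_measurable_diff borel_measurable_divide
          borel_measurable_abs borel_measurable_sum) auto
    qed
    moreover have "{z\<in>space ?\<mu>. (\<Sum>i\<in>{1..2*n}. (C (z i))\<^sup>2) \<le> 4 * real n * \<tau>\<^sup>2} \<in> sets ?\<mu>"
      by measurable
    ultimately show ?thesis
      unfolding \<Psi>_def[abs_def]
      by (intro borel_measurable_times_ennreal borel_measurable_SUP borel_measurable_indicator F0(2)) auto
  qed
  have "(\<integral>\<^sup>+z. \<Psi> z \<partial>?\<mu>) \<le> ennreal (exp (- (3/100) * s) / 2)"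
  proof (rule nn_integral_symmetrize[OF P \<Psi>_meas])
    fix z assume z: "z \<in> space ?\<mu>"
    show "(\<Sum>\<sigma>\<in>Pow {1..n}. \<Psi> (\<lambda>i\<in>{1..2*n}. z (swap_halves n \<sigma> i))) \<le> 2 ^ n * ennreal (exp (- (3/100) * s) / 2)"
    proof (cases "(\<Sum>i\<in>{1..2*n}. (C (z i))\<^sup>2) \<le> 4 * real n * \<tau>\<^sup>2")
      case True
      have "\<Psi> (\<lambda>i\<in>{1..2*n}. z (swap_halves n \<sigma> i))
          \<le> (SUP f\<in>F. ennreal (\<bar>\<Sum>j\<in>{1..n}. rsign \<sigma> j * (f (z j) - f (z (n + j)))\<bar> / L - c))"
        (is "\<Psi> ?z \<le> _") if \<sigma>: "\<sigma> \<in> Pow {1..n}" for \<sigma>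
      proof -
        have "(\<Sum>j\<in>{1..n}. f (?z j) - f (?z (n + j)))
            = (\<Sum>j\<in>{1..n}. rsign \<sigma> j * (f (z j) - f (z (n + j))))" for f :: "'a \<Rightarrow> real"
          using diff_swap_halves[of \<sigma> n _ "\<lambda>i. f (z i)"] \<sigma> by (intro sum.cong) auto
        then have "\<Psi> ?z \<le> (SUP f\<in>F0. ennreal (\<bar>\<Sum>j\<in>{1..n}. rsign \<sigma> j * (f (z j) - f (z (n + j)))\<bar> / L - c))"
          unfolding \<Psi>_def by (simp add: indicator_def)
        also have "\<dots> \<le> (SUP f\<in>F. ennreal (\<bar>\<Sum>j\<in>{1..n}. rsign \<sigma> j * (f (z j) - f (z (n + j)))\<bar> / L - c))"
          using F0 by (intro SUP_subset_mono) auto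
        finally show ?thesis .
      qed
      then have "(\<Sum>\<sigma>\<in>Pow {1..n}. \<Psi> (\<lambda>i\<in>{1..2*n}. z (swap_halves n \<sigma> i)))
          \<le> (\<Sum>\<sigma>\<in>Pow {1..n}. SUP f\<in>F. ennreal (\<bar>\<Sum>j\<in>{1..n}. rsign \<sigma> j * (f (z j) - f (z (n + j)))\<bar> / L - c))"
        by (rule sum_mono)
      also have "\<dots> \<le> 2 ^ n * ennreal (exp (- (3/100) * s) / 2)"
        unfolding L_def c_def Jr_def using F by (intro symmetrized_process_excess n C(1) J s0 \<tau>(2) True) auto
      finally show ?thesis .
    next
      case False
      have "\<Psi> (\<lambda>i\<in>{1..2*n}. z (swap_halves n \<sigma> i)) = 0" if "\<sigma> \<in> Pow {1..n}" for \<sigma>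
      proof -
        have "(\<Sum>i\<in>{1..2*n}. (C (z (swap_halves n \<sigma> i)))\<^sup>2) = (\<Sum>i\<in>{1..2*n}. (C (z i))\<^sup>2)"
          using bij_betw_swap_halves[of \<sigma> n] that by (intro sum.reindex_bij_betw) auto
        then show ?thesis using False by (auto simp: \<Psi>_def indicator_def)
      qed
      then show ?thesis by simp
    qed
  qed
  moreover have "(\<integral>\<^sup>+z. \<Psi> z \<partial>?\<mu>) = (\<integral>\<^sup>+x. \<integral>\<^sup>+y. \<Psi> (merge I I' (x, y)) \<partial>?\<mu>2 \<partial>?\<mu>1)"
    using product_nn_integral_fold[of I I' \<Psi>] II' \<Psi>_meas by simp
  moreover define A where "A = {z \<in> space ?\<mu>1.
      (\<exists>f\<in>F0. b < \<bar>(\<Sum>j\<in>I. f (z j)) - real n * (LINT x|P. f x)\<bar> / L) \<and> (\<Sum>j\<in>I. (C (z j))\<^sup>2) \<le> 2 * real n * \<tau>\<^sup>2}"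
  have A_sets: "A \<in> sets ?\<mu>1"
    unfolding A_def using Fm F0(2) by (intro deviation_event_sets) auto
  \<comment> \<open>For a sample in \<open>A\<close> the ghost integral is at least 1/2. This factor
    cancels the 1/2 in the bound for the integral of \<open>\<Psi>\<close>, leaving no constant
    before the exponential.\<close>
  moreover have "ennreal (1/2) * emeasure ?\<mu>1 A \<le> (\<integral>\<^sup>+x. \<integral>\<^sup>+y. \<Psi> (merge I I' (x, y)) \<partial>?\<mu>2 \<partial>?\<mu>1)"
  proof -
    have "ennreal (1/2) * indicator A x \<le> (\<integral>\<^sup>+y. \<Psi> (merge I I' (x, y)) \<partial>?\<mu>2)" for x
    proof (cases "x \<in> A")
      case True
      then obtain f where f: "f \<in> F0" "b < \<bar>(\<Sum>j\<in>I. f (x j)) - real n * (LINT x|P. f x)\<bar> / L"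
        and x: "x \<in> space ?\<mu>1" "(\<Sum>j\<in>I. (C (x j))\<^sup>2) \<le> 2 * real n * \<tau>\<^sup>2" by (auto simp: A_def)
      have fC: "\<bar>f z\<bar> \<le> C z" for z using f(1) F0(1) F(3) by blast
      have "integrable P f"
      proof (rule Bochner_Integration.integrable_bound)
        show "integrable P (\<lambda>x. 1 + (C x)\<^sup>2)" using C(2) by simp
        have "\<bar>f z\<bar> \<le> 1 + (C z)\<^sup>2" for z
        proof -
          have "0 \<le> (C z - 1/2)\<^sup>2" by simp
          then have "C z \<le> 1 + (C z)\<^sup>2" by (simp add: power2_eq_square algebra_simps)
          with fC[of z] show ?thesis by linarith
        qed
        then show "AE x in P. norm (f x) \<le> norm (1 + (C x)\<^sup>2)" by (auto intro!: AE_I2)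
      qed (use Fm f in auto)
      have "ennreal (1/2) \<le> ennreal ((b - 1 - c) / 2)" using b by (intro ennreal_leI)
      also have "\<dots> \<le> (\<integral>\<^sup>+y. ennreal (\<bar>(\<Sum>j\<in>I. f (x j)) - (\<Sum>j\<in>I'. f (y j))\<bar> / (sqrt (card I') * \<tau>) - c)
          * indicator {w\<in>space ?\<mu>2. (\<Sum>j\<in>I'. (C (w j))\<^sup>2) \<le> 2 * real (card I') * \<tau>\<^sup>2} y \<partial>?\<mu>2)"
        using f b II' \<open>integrable P f\<close> Fm fC unfolding L_def
        by (intro PiM_ghost_excess[OF P _ _ C(2) _ _ _ _ \<tau>]) auto
      also have "\<dots> \<le> (\<integral>\<^sup>+y. \<Psi> (merge I I' (x, y)) \<partial>?\<mu>2)"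
      proof (rule nn_integral_mono)
        fix y assume y: "y \<in> space ?\<mu>2"
        let ?z = "merge I I' (x, y)"
        have z: "?z \<in> space ?\<mu>"
          using measurable_space[OF measurable_merge[of I I' "\<lambda>_. P"], of "(x, y)"] x y II'
          by (simp add: space_pair_measure)
        have sum1: "(\<Sum>j\<in>I. g (?z j)) = (\<Sum>j\<in>I. g (x j))" for g :: "'a \<Rightarrow> real"
          by (intro sum.cong) (auto simp: merge_def)
        have shift: "(\<Sum>j\<in>I'. h j) = (\<Sum>j\<in>{1..n}. h (n + j))" for h :: "nat \<Rightarrow> real"
          unfolding I'_def using sum.shift_bounds_cl_nat_ivl[of h 1 n n] by (simp add: add.commute)
        have sum2: "(\<Sum>j\<in>I'. g (y j)) = (\<Sum>j\<in>{1..n}. g (?z (n + j)))" for g :: "'a \<Rightarrow> real"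
        proof -
          have "(\<Sum>j\<in>I'. g (y j)) = (\<Sum>j\<in>I'. g (?z j))"
            using II' by (intro sum.cong) (auto simp: merge_def)
          also have "\<dots> = (\<Sum>j\<in>{1..n}. g (?z (n + j)))"
            by (rule shift)
          finally show ?thesis .
        qed
        show "ennreal (\<bar>(\<Sum>j\<in>I. f (x j)) - (\<Sum>j\<in>I'. f (y j))\<bar> / (sqrt (card I') * \<tau>) - c)
          * indicator {w\<in>space ?\<mu>2. (\<Sum>j\<in>I'. (C (w j))\<^sup>2) \<le> 2 * real (card I') * \<tau>\<^sup>2} y \<le> \<Psi> ?z"
        proof (cases "(\<Sum>j\<in>I'. (C (y j))\<^sup>2) \<le> 2 * real n * \<tau>\<^sup>2")
          case True
          have "(\<Sum>i\<in>{1..2*n}. (C (?z i))\<^sup>2) = (\<Sum>j\<in>I. (C (x j))\<^sup>2) + (\<Sum>j\<in>I'. (C (y j))\<^sup>2)"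
            unfolding sum_Icc_double sum.distrib using sum1[of "\<lambda>x. (C x)\<^sup>2"] sum2[of "\<lambda>x. (C x)\<^sup>2"]
            by (simp add: I_def)
          then have "(\<Sum>i\<in>{1..2*n}. (C (?z i))\<^sup>2) \<le> 4 * real n * \<tau>\<^sup>2" using True x by simp
          moreover have "ennreal (\<bar>(\<Sum>j\<in>I. f (x j)) - (\<Sum>j\<in>I'. f (y j))\<bar> / L - c)
              \<le> (SUP f\<in>F0. ennreal (\<bar>\<Sum>j\<in>{1..n}. f (?z j) - f (?z (n + j))\<bar> / L - c))"
            using f(1) sum1[of f] sum2[of f] by (intro SUP_upper2[of f]) (auto simp: sum_subtractf I_def)
          ultimately show ?thesis using z II' by (auto simp: \<Psi>_def indicator_def L_def)
        qed (use II' in simp)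
      qed
      finally show ?thesis using True by simp
    qed simp
    then have "(\<integral>\<^sup>+x. ennreal (1/2) * indicator A x \<partial>?\<mu>1) \<le> (\<integral>\<^sup>+x. \<integral>\<^sup>+y. \<Psi> (merge I I' (x, y)) \<partial>?\<mu>2 \<partial>?\<mu>1)"
      by (intro nn_integral_mono)
    then show ?thesis using A_sets by (simp add: nn_integral_cmult_indicator)
  qed
  moreover have "ennreal (1/2 * measure ?\<mu>1 A) = ennreal (1/2) * emeasure ?\<mu>1 A"
    unfolding \<mu>1.emeasure_eq_measure by (intro ennreal_mult) auto
  ultimately have "ennreal (1/2 * measure ?\<mu>1 A) \<le> ennreal (exp (- (3/100) * s) / 2)" by simp
  then have "measure ?\<mu>1 A \<le> exp (- (3/100) * s)" by (subst (asm) ennreal_le_iff) auto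
  then show ?thesis by (simp only: A_def I_def b_def L_def)
qed

section \<open>Sample average approximation\<close>

lemma cINF_dense:
  fixes f :: "'b \<Rightarrow> real"
  assumes A': "A' \<subseteq> A" "A' \<noteq> {}" and bdd: "bdd_below (f ` A)"
    and dense: "\<And>x \<delta>. x \<in> A \<Longrightarrow> \<delta> > 0 \<Longrightarrow> \<exists>y\<in>A'. \<bar>f x - f y\<bar> \<le> \<delta>"
  shows "(INF x\<in>A. f x) = (INF x\<in>A'. f x)"
proof (rule antisym)
  show "(INF x\<in>A. f x) \<le> (INF x\<in>A'. f x)" using A' bdd by (intro cINF_superset_mono) auto
  have bdd': "bdd_below (f ` A')" by (rule bdd_below_mono[OF bdd]) (use A' in auto)
  show "(INF x\<in>A'. f x) \<le> (INF x\<in>A. f x)"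
  proof (rule cINF_greatest)
    fix x assume x: "x \<in> A"
    show "(INF x\<in>A'. f x) \<le> f x"
    proof (rule field_le_epsilon)
      fix \<delta> :: real assume "\<delta> > 0"
      then obtain y where y: "y \<in> A'" "\<bar>f x - f y\<bar> \<le> \<delta>" using dense[OF x] by blast
      then show "(INF x\<in>A'. f x) \<le> f x + \<delta>" using cINF_lower[OF bdd' y(1)] by linarith
    qed
  qed (use A' in auto)
qed

lemma abs_diff_cINF_le:
  fixes f g :: "'b \<Rightarrow> real"
  assumes A: "A \<noteq> {}" and bdd: "bdd_below (f ` A)" "bdd_below (g ` A)" "bdd_above ((\<lambda>x. \<bar>f x - g x\<bar>) ` A)"
  shows "\<bar>(INF x\<in>A. f x) - (INF x\<in>A. g x)\<bar> \<le> (SUP x\<in>A. \<bar>f x - g x\<bar>)"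
proof -
  let ?S = "SUP x\<in>A. \<bar>f x - g x\<bar>"
  have S: "\<bar>f x - g x\<bar> \<le> ?S" if "x \<in> A" for x using cSUP_upper[OF that bdd(3)] .
  have "(INF x\<in>A. g x) - ?S \<le> (INF x\<in>A. f x)"
    using S cINF_lower[OF bdd(2)] by (intro cINF_greatest A) (smt (verit))
  moreover have "(INF x\<in>A. f x) - ?S \<le> (INF x\<in>A. g x)"
    using S cINF_lower[OF bdd(1)] by (intro cINF_greatest A) (smt (verit))
  ultimately show ?thesis by linarith
qed

text \<open>In the first branch ln (1 + u) \<le> u \<le> 1/5 and sqrt 2 \<ge> 5/4 give (3/5) / (5/2)
  = 6/25; the second branch stays below 1/5.\<close>

lemma frak_f_bounds:
  assumes "t > 0"
  shows "0 \<le> frak_f n t" "frak_f n t \<le> 6/25"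
proof -
  have "t / (5 * t + 28) \<le> 6/25" using assms by (simp add: divide_le_eq)
  moreover have "3 * sqrt (real n) * ln (1 + t / (5 * t + 17)) / (2 * (sqrt (2 * real n) + 1)) \<le> 6/25"
  proof -
    have "ln (1 + t / (5 * t + 17)) \<le> t / (5 * t + 17)"
      using assms by (intro ln_add_one_self_le_self) auto
    also have "\<dots> \<le> 1/5" using assms by (simp add: divide_le_eq)
    finally have ln: "ln (1 + t / (5 * t + 17)) \<le> 1/5" .
    have "sqrt 2 \<ge> 5/4" by (rule real_le_rsqrt) (simp add: power_divide)
    then have "5/4 * sqrt n \<le> sqrt (2 * real n)"
      unfolding real_sqrt_mult by (intro mult_right_mono) auto
    then have "3 * sqrt n * (1/5) \<le> 6/25 * (2 * (sqrt (2 * real n) + 1))" by simp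
    moreover have "3 * sqrt n * ln (1 + t / (5 * t + 17)) \<le> 3 * sqrt n * (1/5)"
      using ln by (intro mult_left_mono) auto
    moreover have "0 < 2 * (sqrt (2 * real n) + 1)" by (simp add: add_nonneg_pos)
    ultimately show ?thesis by (simp add: pos_divide_le_eq)
  qed
  ultimately show "frak_f n t \<le> 6/25" by (simp add: frak_f_def)
  show "0 \<le> frak_f n t" using assms by (simp add: frak_f_def le_max_iff_disj)
qed

theorem theorem2p2:
  fixes M :: "'w measure"
    and Z :: "nat \<Rightarrow> 'w \<Rightarrow> real ^ 'd::finite"
    and PZ :: "(real ^ 'd) measure"
    and \<Theta> \<Theta>' :: "(real ^ 'm::finite) set"
    and G :: "real ^ 'm \<Rightarrow> real ^ 'd \<Rightarrow> real"
    and \<xi> :: "real ^ 'd \<Rightarrow> real"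
    and N :: "nat \<Rightarrow> (nat \<Rightarrow> real ^ 'd) set"
    and \<epsilon> t :: real and n :: nat
  assumes Theta: "\<Theta> \<noteq> {}" "compact \<Theta>"
    and prob: "prob_space M" "complete_measure M" "atomless M"
    and iid: "prob_space.indep_vars M (\<lambda>_. borel) Z {1..}"
      "\<And>j. j \<ge> 1 \<Longrightarrow> distr M borel (Z j) = PZ"
    and A1: "\<And>\<theta>. \<theta> \<in> \<Theta> \<Longrightarrow> G \<theta> \<in> borel_measurable borel"
    and A2: "\<xi> \<in> borel_measurable borel" "\<And>z. \<xi> z > 0" "integrable PZ \<xi>"
      "\<And>\<theta> z. \<theta> \<in> \<Theta> \<Longrightarrow> \<bar>G \<theta> z\<bar> \<le> \<xi> z"
    and A3: "countable \<Theta>'" "\<Theta>' \<subseteq> \<Theta>"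
      "\<And>k. k \<ge> 1 \<Longrightarrow> N k \<in> null_sets (Pi\<^sub>M {1..k} (\<lambda>_. PZ))"
      "\<And>\<theta>. \<theta> \<in> \<Theta> \<Longrightarrow>
         (INF \<theta>'\<in>\<Theta>'. ereal \<bar>(LINT \<omega>|M. G \<theta>' (Z 1 \<omega>)) - (LINT \<omega>|M. G \<theta> (Z 1 \<omega>))\<bar>) = 0"
      "\<And>k \<theta> z. k \<ge> 1 \<Longrightarrow> \<theta> \<in> \<Theta> \<Longrightarrow> z \<in> space (Pi\<^sub>M {1..k} (\<lambda>_. PZ)) - N k \<Longrightarrow>
         (INF \<theta>'\<in>\<Theta>'. ereal (MAX j\<in>{1..k}. \<bar>G \<theta> (z j) - G \<theta>' (z j)\<bar>)) = 0"
    and square_integrable: "integrable PZ (\<lambda>z. (\<xi> z)\<^sup>2)"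
    and J_finite: "J_integral (G ` \<Theta>) \<xi> (1 / 2) < \<infinity>"
    and eps: "\<epsilon> > 0"
    and t: "t > 0"
    and n: "n \<ge> 1" "\<epsilon> > eta_bound PZ (G ` \<Theta>) \<xi> t n" "real n \<ge> (Lp_norm PZ 2 \<xi>)\<^sup>2 / 2"
  shows "measure M {\<omega> \<in> space M.
             \<bar>(INF \<theta>\<in>\<Theta>. emp_mean Z n (G \<theta>) \<omega>) - (INF \<theta>\<in>\<Theta>. LINT \<omega>'|M. G \<theta> (Z 1 \<omega>'))\<bar> \<ge> \<epsilon>}
         \<le> measure M {\<omega> \<in> space M.
             (SUP \<theta>\<in>\<Theta>'. \<bar>emp_mean Z n (G \<theta>) \<omega> - (LINT \<omega>'|M. G \<theta> (Z 1 \<omega>'))\<bar>) \<ge> \<epsilon>}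
       \<and> measure M {\<omega> \<in> space M.
             (SUP \<theta>\<in>\<Theta>'. \<bar>emp_mean Z n (G \<theta>) \<omega> - (LINT \<omega>'|M. G \<theta> (Z 1 \<omega>'))\<bar>) \<ge> \<epsilon>}
         \<le> exp (- t * sqrt (real n) * \<epsilon> / (8 * (t + 1) * Lp_norm PZ 2 \<xi>) * frak_f n t)
             + measure M (space M - B_event M Z \<xi> n)"
proof -
  interpret M: prob_space M by (rule prob(1))
  have Z[measurable]: "Z j \<in> borel_measurable M" if "j \<ge> 1" for j
    using iid(1) that by (auto simp: M.indep_vars_def)
  have PZ: "PZ = distr M borel (Z 1)" using iid(2)[of 1] by simp
  have sets_PZ[measurable_cong]: "sets PZ = sets borel" by (simp add: PZ)
  have prob_PZ: "prob_space PZ" unfolding PZ by (intro M.prob_space_distr) (simp add: Z)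
  interpret PZ: prob_space PZ by (rule prob_PZ)
  have meas_PZ: "f \<in> borel_measurable PZ" if "f \<in> borel_measurable borel" for f :: "real ^ 'd \<Rightarrow> real"
    using that measurable_cong_sets[OF sets_PZ refl] by blast
  have E_PZ: "(LINT \<omega>|M. f (Z 1 \<omega>)) = (LINT x|PZ. f x)" if "f \<in> borel_measurable borel" for f :: "real ^ 'd \<Rightarrow> real"
    unfolding PZ using that by (intro integral_distr[symmetric]) (auto simp: Z)
  define E where "E \<theta> = (LINT x|PZ. G \<theta> x)" for \<theta>
  have E: "(LINT \<omega>|M. G \<theta> (Z 1 \<omega>)) = E \<theta>" if "\<theta> \<in> \<Theta>" for \<theta>
    unfolding E_def by (rule E_PZ[OF A1[OF that]])
  \<comment> \<open>The infima in \<open>A3\<close> are taken in \<open>ereal\<close>, where the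
    empty infimum is infinite and hence not 0.\<close>
  have \<Theta>': "\<Theta>' \<noteq> {}"
  proof
    obtain \<theta> where "\<theta> \<in> \<Theta>" using Theta by blast
    moreover assume "\<Theta>' = {}"
    ultimately show False using A3(4)[of \<theta>] by (simp add: top_ereal_def)
  qed
  define \<mu> where "\<mu> = Pi\<^sub>M {1..n} (\<lambda>_. PZ)"
  define X where "X \<omega> = (\<lambda>j\<in>{1..n}. Z j \<omega>)" for \<omega>
  have sets_\<mu>: "sets \<mu> = sets (Pi\<^sub>M {1..n} (\<lambda>_. borel :: (real ^ 'd) measure))"
    unfolding \<mu>_def by (intro sets_PiM_cong) (auto simp: sets_PZ)
  have X: "X \<in> measurable M \<mu>"
    unfolding X_def \<mu>_def
    by (rule measurable_restrict) (use Z measurable_cong_sets[OF refl sets_PZ] in auto)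
  have distr_X: "distr M \<mu> X = \<mu>"
  proof -
    have "M.indep_vars (\<lambda>_. borel) Z {1..n}" using iid(1) by (rule M.indep_vars_subset) auto
    then have "distr M (Pi\<^sub>M {1..n} (\<lambda>_. borel)) (\<lambda>x. \<lambda>i\<in>{1..n}. Z i x) = (\<Pi>\<^sub>M i\<in>{1..n}. distr M borel (Z i))"
      using n(1) Z by (subst (asm) M.indep_vars_iff_distr_eq_PiM') auto
    also have "\<dots> = \<mu>" unfolding \<mu>_def using iid(2) by (intro PiM_cong) auto
    also have "distr M (Pi\<^sub>M {1..n} (\<lambda>_. borel)) (\<lambda>x. \<lambda>i\<in>{1..n}. Z i x) = distr M \<mu> X"
      using sets_\<mu> by (intro distr_cong) (auto simp: X_def)
    finally show ?thesis .
  qed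
  have emp: "emp_mean Z n f \<omega> = (\<Sum>j\<in>{1..n}. f (X \<omega> j)) / real n" for f \<omega>
    by (simp add: emp_mean_def X_def)
  have emp_diff: "\<bar>emp_mean Z n f \<omega> - emp_mean Z n g \<omega>\<bar> \<le> \<delta>"
    if "\<And>j. j \<in> {1..n} \<Longrightarrow> \<bar>f (X \<omega> j) - g (X \<omega> j)\<bar> \<le> \<delta>" for f g \<omega> \<delta>
  proof -
    have "\<bar>(\<Sum>j\<in>{1..n}. f (X \<omega> j)) - (\<Sum>j\<in>{1..n}. g (X \<omega> j))\<bar> \<le> (\<Sum>j\<in>{1..n}. \<bar>f (X \<omega> j) - g (X \<omega> j)\<bar>)"
      unfolding sum_subtractf[symmetric] by (rule sum_abs)
    also have "\<dots> \<le> (\<Sum>j\<in>{1..n}. \<delta>)" by (intro sum_mono that)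
    finally have "\<bar>(\<Sum>j\<in>{1..n}. f (X \<omega> j)) - (\<Sum>j\<in>{1..n}. g (X \<omega> j))\<bar> \<le> real n * \<delta>" by simp
    then show ?thesis
      unfolding emp diff_divide_distrib[symmetric] abs_divide using n(1) by (simp add: divide_le_eq mult.commute)
  qed
  have E_bound: "\<bar>E \<theta>\<bar> \<le> (LINT x|PZ. \<xi> x)" if "\<theta> \<in> \<Theta>" for \<theta>
  proof -
    have int: "integrable PZ (G \<theta>)"
      by (rule Bochner_Integration.integrable_bound[OF A2(3) meas_PZ[OF A1[OF that]]])
        (use A2(4)[OF that] in \<open>auto intro!: AE_I2 order_trans[OF _ abs_ge_self]\<close>)
    have "\<bar>E \<theta>\<bar> \<le> (LINT x|PZ. \<bar>G \<theta> x\<bar>)" unfolding E_def by (rule integral_abs_bound)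
    also have "\<dots> \<le> (LINT x|PZ. \<xi> x)"
      using int A2(3) A2(4)[OF that] by (intro integral_mono integrable_abs)
    finally show ?thesis .
  qed
  have emp_bound: "\<bar>emp_mean Z n (G \<theta>) \<omega>\<bar> \<le> emp_mean Z n \<xi> \<omega>" if "\<theta> \<in> \<Theta>" for \<theta> \<omega>
    unfolding emp abs_divide using A2(4)[OF that]
    by (auto intro!: divide_right_mono order_trans[OF sum_abs] sum_mono)
  have bdd_E: "bdd_below (E ` \<Theta>)"
    by (rule bdd_belowI2[of _ "- (LINT x|PZ. \<xi> x)"]) (use E_bound in \<open>auto simp: abs_le_iff minus_le_iff\<close>)
  have bdd_emp: "bdd_below ((\<lambda>\<theta>. emp_mean Z n (G \<theta>) \<omega>) ` \<Theta>)" for \<omega>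
    by (rule bdd_belowI2[of _ "- emp_mean Z n \<xi> \<omega>"]) (use emp_bound[of _ \<omega>] in \<open>auto simp: abs_le_iff minus_le_iff\<close>)
  have bdd_dev: "bdd_above ((\<lambda>\<theta>. \<bar>emp_mean Z n (G \<theta>) \<omega> - E \<theta>\<bar>) ` \<Theta>')" for \<omega>
  proof (rule bdd_aboveI2[of _ _ "emp_mean Z n \<xi> \<omega> + (LINT x|PZ. \<xi> x)"])
    fix \<theta> assume "\<theta> \<in> \<Theta>'"
    then have "\<theta> \<in> \<Theta>" using A3(2) by blast
    then show "\<bar>emp_mean Z n (G \<theta>) \<omega> - E \<theta>\<bar> \<le> emp_mean Z n \<xi> \<omega> + (LINT x|PZ. \<xi> x)"
      using E_bound[of \<theta>] emp_bound[of \<theta> \<omega>] by linarith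
  qed
  define S where "S = {\<omega> \<in> space M. (SUP \<theta>\<in>\<Theta>'. \<bar>emp_mean Z n (G \<theta>) \<omega> - E \<theta>\<bar>) \<ge> \<epsilon>}"
  have S_eq: "{\<omega> \<in> space M. (SUP \<theta>\<in>\<Theta>'. \<bar>emp_mean Z n (G \<theta>) \<omega> - (LINT \<omega>'|M. G \<theta> (Z 1 \<omega>'))\<bar>) \<ge> \<epsilon>} = S"
  proof -
    have "(SUP \<theta>\<in>\<Theta>'. \<bar>emp_mean Z n (G \<theta>) \<omega> - (LINT \<omega>'|M. G \<theta> (Z 1 \<omega>'))\<bar>)
        = (SUP \<theta>\<in>\<Theta>'. \<bar>emp_mean Z n (G \<theta>) \<omega> - E \<theta>\<bar>)" for \<omega>
      using A3(2) by (intro SUP_cong) (auto simp: E[unfolded One_nat_def] subset_iff)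
    then show ?thesis by (simp add: S_def)
  qed
  have emp_meas: "emp_mean Z n f \<in> borel_measurable M" if "f \<in> borel_measurable borel" for f
  proof -
    have "(\<lambda>\<omega>. f (Z j \<omega>)) \<in> borel_measurable M" if "j \<in> {1..n}" for j
      using measurable_compose[OF Z \<open>f \<in> _\<close>] that by simp
    then show ?thesis unfolding emp_mean_def[abs_def]
      by (intro borel_measurable_times borel_measurable_sum) auto
  qed
  have S_sets: "S \<in> sets M"
  proof -
    have "(\<lambda>\<omega>. SUP \<theta>\<in>\<Theta>'. \<bar>emp_mean Z n (G \<theta>) \<omega> - E \<theta>\<bar>) \<in> borel_measurable M"
      using A3(1,2) bdd_dev emp_meas A1
      by (intro borel_measurable_cSUP borel_measurable_abs borel_measurable_diff) (auto simp: subset_iff)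
    then show ?thesis unfolding S_def by measurable
  qed
  have "measure M {\<omega> \<in> space M.
      \<bar>(INF \<theta>\<in>\<Theta>. emp_mean Z n (G \<theta>) \<omega>) - (INF \<theta>\<in>\<Theta>. LINT \<omega>'|M. G \<theta> (Z 1 \<omega>'))\<bar> \<ge> \<epsilon>} \<le> measure M S"
    (is "measure M ?I \<le> _")
  proof -
    \<comment> \<open>The approximation in \<open>A3\<close> holds off \<open>N n\<close>; its
      preimage under \<open>X\<close> is null because \<open>X\<close> has law
      \<open>\<mu>\<close>.\<close>
    define N' where "N' = X -` N n \<inter> space M"
    have Nn: "N n \<in> null_sets \<mu>" using A3(3)[OF n(1)] by (simp add: \<mu>_def)
    then have N': "N' \<in> sets M" unfolding N'_def using X by (auto intro: measurable_sets)
    have "emeasure M N' = emeasure (distr M \<mu> X) (N n)"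
      unfolding N'_def using Nn X by (intro emeasure_distr[symmetric]) auto
    also have "\<dots> = 0" using Nn by (simp add: distr_X null_setsD1)
    finally have N'0: "measure M N' = 0" by (simp add: measure_def)
    have "?I \<subseteq> S \<union> N'"
    proof
      fix \<omega> assume \<omega>: "\<omega> \<in> ?I"
      show "\<omega> \<in> S \<union> N'"
      proof (cases "X \<omega> \<in> N n")
        case True
        with \<omega> show ?thesis by (simp add: N'_def)
      next
        case False
        have "X \<omega> \<in> space \<mu>" using \<omega> X by (auto dest: measurable_space)
        with False have z: "X \<omega> \<in> space (Pi\<^sub>M {1..n} (\<lambda>_. PZ)) - N n" by (simp add: \<mu>_def)
        \<comment> \<open>Sample means and expectations may be approximated by different points of
          \<open>\<Theta>'\<close>; this suffices, as each infimum is transferred on its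
          own.\<close>
        have "(INF \<theta>\<in>\<Theta>. emp_mean Z n (G \<theta>) \<omega>) = (INF \<theta>\<in>\<Theta>'. emp_mean Z n (G \<theta>) \<omega>)"
        proof (rule cINF_dense[OF A3(2) \<Theta>' bdd_emp])
          fix \<theta> and \<delta> :: real assume "\<theta> \<in> \<Theta>" "\<delta> > 0"
          then have "(INF \<theta>'\<in>\<Theta>'. ereal (MAX j\<in>{1..n}. \<bar>G \<theta> (X \<omega> j) - G \<theta>' (X \<omega> j)\<bar>)) < ereal \<delta>"
            using A3(5)[OF n(1) _ z] by simp
          then obtain \<theta>' where \<theta>': "\<theta>' \<in> \<Theta>'" "(MAX j\<in>{1..n}. \<bar>G \<theta> (X \<omega> j) - G \<theta>' (X \<omega> j)\<bar>) < \<delta>"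
            by (auto simp: INF_less_iff)
          have "\<bar>G \<theta> (X \<omega> j) - G \<theta>' (X \<omega> j)\<bar> \<le> \<delta>" if "j \<in> {1..n}" for j
            by (rule order_trans[OF Max_ge less_imp_le[OF \<theta>'(2)]]) (use that in auto)
          then show "\<exists>\<theta>'\<in>\<Theta>'. \<bar>emp_mean Z n (G \<theta>) \<omega> - emp_mean Z n (G \<theta>') \<omega>\<bar> \<le> \<delta>"
            using \<theta>'(1) emp_diff by blast
        qed
        moreover have "(INF \<theta>\<in>\<Theta>. E \<theta>) = (INF \<theta>\<in>\<Theta>'. E \<theta>)"
        proof (rule cINF_dense[OF A3(2) \<Theta>' bdd_E])
          fix \<theta> and \<delta> :: real assume \<theta>: "\<theta> \<in> \<Theta>" "\<delta> > 0"
          then have "(INF \<theta>'\<in>\<Theta>'. ereal \<bar>(LINT \<omega>|M. G \<theta>' (Z 1 \<omega>)) - (LINT \<omega>|M. G \<theta> (Z 1 \<omega>))\<bar>) < ereal \<delta>"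
            using A3(4) by simp
          then obtain \<theta>' where \<theta>': "\<theta>' \<in> \<Theta>'"
            "\<bar>(LINT \<omega>|M. G \<theta>' (Z 1 \<omega>)) - (LINT \<omega>|M. G \<theta> (Z 1 \<omega>))\<bar> < \<delta>"
            by (auto simp: INF_less_iff)
          then have "\<bar>E \<theta> - E \<theta>'\<bar> \<le> \<delta>" using E[OF \<theta>(1)] E[of \<theta>'] A3(2) by auto
          then show "\<exists>\<theta>'\<in>\<Theta>'. \<bar>E \<theta> - E \<theta>'\<bar> \<le> \<delta>" using \<theta>'(1) by blast
        qed
        moreover have "(INF \<theta>\<in>\<Theta>. LINT \<omega>'|M. G \<theta> (Z 1 \<omega>')) = (INF \<theta>\<in>\<Theta>. E \<theta>)"
          by (intro INF_cong refl E)
        ultimately have "\<epsilon> \<le> \<bar>(INF \<theta>\<in>\<Theta>'. emp_mean Z n (G \<theta>) \<omega>) - (INF \<theta>\<in>\<Theta>'. E \<theta>)\<bar>"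
          using \<omega> by simp
        also have "\<dots> \<le> (SUP \<theta>\<in>\<Theta>'. \<bar>emp_mean Z n (G \<theta>) \<omega> - E \<theta>\<bar>)"
          by (intro abs_diff_cINF_le \<Theta>' bdd_dev bdd_below_mono[OF bdd_emp image_mono[OF A3(2)]]
            bdd_below_mono[OF bdd_E image_mono[OF A3(2)]])
        finally show ?thesis using \<omega> by (simp add: S_def)
      qed
    qed
    \<comment> \<open>Monotonicity asks for measurability of the larger set only; \<open>?I\<close>
      involves infima over a possibly uncountable set.\<close>
    then have "measure M ?I \<le> measure M (S \<union> N')" using S_sets N' by (intro M.finite_measure_mono) auto
    also have "\<dots> \<le> measure M S + measure M N'" using S_sets N' by (intro measure_Un_le)
    finally show ?thesis using N'0 by simp
  qed
  moreover have "measure M S \<le> exp (- t * sqrt (real n) * \<epsilon> / (8 * (t + 1) * Lp_norm PZ 2 \<xi>) * frak_f n t)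
      + measure M (space M - B_event M Z \<xi> n)"
  proof -
    define \<tau> where "\<tau> = Lp_norm PZ 2 \<xi>"
    define J where "J = enn2real (J_integral (G ` \<Theta>) \<xi> (1/4))"
    define s where "s = sqrt n * \<epsilon> / \<tau>"
    have \<xi>2: "0 < (LINT x|PZ. (\<xi> x)\<^sup>2)"
    proof -
      have "\<not> (AE x in PZ. (\<xi> x)\<^sup>2 = 0)"
        using A2(2) by (auto simp: less_le)
      then show ?thesis
        using integral_nonneg_eq_0_iff_AE[OF square_integrable] by (simp add: less_le)
    qed
    have \<tau>: "(LINT x|PZ. (\<xi> x)\<^sup>2) = \<tau>\<^sup>2" "\<tau> > 0"
      using \<xi>2 by (auto simp: \<tau>_def Lp_norm_def powr_half_sqrt)
    have "J \<ge> 0" by (simp add: J_def)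
    have J_fin: "J_integral (G ` \<Theta>) \<xi> (1/4) < \<infinity>"
      using J_integral_mono[of "1/4" "1/2" "G ` \<Theta>" \<xi>] J_finite by simp
    have "\<epsilon> > \<tau> / sqrt n + 32 * sqrt 2 * (1 + t) * \<tau> * J / sqrt n"
      using n(2) by (simp add: eta_bound_def \<tau>_def J_def)
    \<comment> \<open>Measured in units of \<tau> / sqrt n, the hypothesis on \<epsilon> becomes a
      lower bound on \<open>s\<close>, in which 1 + t is then lowered to 1.\<close>
    then have "sqrt n / \<tau> * (\<tau> / sqrt n + 32 * sqrt 2 * (1 + t) * \<tau> * J / sqrt n) \<le> sqrt n / \<tau> * \<epsilon>"
      using \<tau> by (intro mult_left_mono) auto
    also have "sqrt n / \<tau> * (\<tau> / sqrt n + 32 * sqrt 2 * (1 + t) * \<tau> * J / sqrt n) = 1 + 32 * sqrt 2 * (1 + t) * J"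
      using \<tau> n(1) by (simp add: field_simps)
    finally have s1: "s \<ge> 1 + 32 * sqrt 2 * (1 + t) * J" by (simp add: s_def)
    have "32 * sqrt 2 * (1 + t) * J \<ge> 32 * sqrt 2 * 1 * J"
      using t \<open>J \<ge> 0\<close> by (intro mult_right_mono mult_left_mono) auto
    with s1 have s: "s \<ge> 1 + 32 * sqrt 2 * J" by linarith
    have s0: "s \<ge> 0" using s \<open>J \<ge> 0\<close> by (smt (verit) mult_nonneg_nonneg real_sqrt_ge_zero)
    define A where "A = {z \<in> space \<mu>.
      (\<exists>f\<in>G ` \<Theta>'. s - 1/100 < \<bar>(\<Sum>j\<in>{1..n}. f (z j)) - real n * (LINT x|PZ. f x)\<bar> / (sqrt n * \<tau>))
      \<and> (\<Sum>j\<in>{1..n}. (\<xi> (z j))\<^sup>2) \<le> 2 * real n * \<tau>\<^sup>2}"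
    have A_le: "measure \<mu> A \<le> exp (- (3/100) * s)"
      unfolding A_def \<mu>_def using Theta A1 A2 A3(1,2) J_fin s
      by (intro uniform_deviation[where F="G ` \<Theta>", OF prob_PZ sets_PZ n(1) _ _ _ A2(1) square_integrable \<tau>])
        (auto simp: J_def)
    have A_sets: "A \<in> sets \<mu>"
      unfolding A_def \<mu>_def using A3(1,2) A1 A2(1) by (intro deviation_event_sets) (auto intro: meas_PZ)
    have B_sets: "B_event M Z \<xi> n \<in> sets M"
      using emp_meas[of "\<lambda>z. (\<xi> z)\<^sup>2"] A2(1) unfolding B_event_def by measurable
    have "S \<subseteq> (X -` A \<inter> space M) \<union> (space M - B_event M Z \<xi> n)"
    proof
      fix \<omega> assume \<omega>: "\<omega> \<in> S"
      show "\<omega> \<in> (X -` A \<inter> space M) \<union> (space M - B_event M Z \<xi> n)"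
      proof (cases "\<omega> \<in> B_event M Z \<xi> n")
        case True
        then have "emp_mean Z n (\<lambda>z. (\<xi> z)\<^sup>2) \<omega> \<le> 2 * \<tau>\<^sup>2"
          using E_PZ[of "\<lambda>z. (\<xi> z)\<^sup>2"] A2(1) \<tau> by (simp add: B_event_def)
        then have "(\<Sum>j\<in>{1..n}. (\<xi> (X \<omega> j))\<^sup>2) \<le> 2 * real n * \<tau>\<^sup>2"
          unfolding emp using n(1) by (simp add: divide_le_eq mult_ac)
        \<comment> \<open>The slack \<tau> / (100 sqrt n) is 1/100 in the units of \<open>s\<close>;
          some \<theta> exceeds the lowered level even if the supremum is not attained.\<close>
        moreover have "\<exists>\<theta>\<in>\<Theta>'. \<epsilon> - \<tau> / (100 * sqrt n) < \<bar>emp_mean Z n (G \<theta>) \<omega> - E \<theta>\<bar>"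
        proof (rule ccontr)
          assume "\<not> ?thesis"
          then have "(SUP \<theta>\<in>\<Theta>'. \<bar>emp_mean Z n (G \<theta>) \<omega> - E \<theta>\<bar>) \<le> \<epsilon> - \<tau> / (100 * sqrt n)"
            by (intro cSUP_least \<Theta>') (auto simp: not_less)
          moreover have "\<tau> / (100 * sqrt n) > 0" using \<tau> n(1) by simp
          ultimately show False using \<omega> by (simp add: S_def)
        qed
        then obtain \<theta> where \<theta>: "\<theta> \<in> \<Theta>'" "\<epsilon> - \<tau> / (100 * sqrt n) < \<bar>emp_mean Z n (G \<theta>) \<omega> - E \<theta>\<bar>" by blast
        have "s - 1/100 < \<bar>(\<Sum>j\<in>{1..n}. G \<theta> (X \<omega> j)) - real n * E \<theta>\<bar> / (sqrt n * \<tau>)"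
        proof -
          have "s - 1/100 = sqrt n / \<tau> * (\<epsilon> - \<tau> / (100 * sqrt n))"
            using \<tau> n(1) by (simp add: s_def field_simps)
          also have "\<dots> < sqrt n / \<tau> * \<bar>emp_mean Z n (G \<theta>) \<omega> - E \<theta>\<bar>"
            using \<tau> n(1) \<theta>(2) by (intro mult_strict_left_mono) auto
          also have "emp_mean Z n (G \<theta>) \<omega> - E \<theta> = ((\<Sum>j\<in>{1..n}. G \<theta> (X \<omega> j)) - real n * E \<theta>) / n"
            unfolding emp using n(1) by (simp add: field_simps)
          also have "sqrt n / \<tau> * \<bar>((\<Sum>j\<in>{1..n}. G \<theta> (X \<omega> j)) - real n * E \<theta>) / n\<bar>
              = \<bar>(\<Sum>j\<in>{1..n}. G \<theta> (X \<omega> j)) - real n * E \<theta>\<bar> * (sqrt n / n) / \<tau>"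
            unfolding abs_divide by (simp add: mult_ac)
          also have "sqrt n / n = 1 / sqrt n" using n(1) by (simp add: real_div_sqrt field_simps)
          finally show ?thesis by (simp add: mult.commute)
        qed
        moreover have "X \<omega> \<in> space \<mu>" "\<omega> \<in> space M" using \<omega> X by (auto simp: S_def dest: measurable_space)
        ultimately show ?thesis using \<theta>(1) by (auto simp: A_def E_def)
      next
        case False
        with \<omega> show ?thesis by (simp add: S_def)
      qed
    qed
    then have "measure M S \<le> measure M ((X -` A \<inter> space M) \<union> (space M - B_event M Z \<xi> n))"
      using A_sets X B_sets by (intro M.finite_measure_mono) (auto intro: measurable_sets)
    also have "\<dots> \<le> measure M (X -` A \<inter> space M) + measure M (space M - B_event M Z \<xi> n)"
      using A_sets X B_sets by (intro measure_Un_le) (auto intro: measurable_sets)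
    also have "measure M (X -` A \<inter> space M) = measure \<mu> A"
      using measure_distr[OF X A_sets] distr_X by simp
    also have "measure \<mu> A \<le> exp (- (3/100) * s)" by (rule A_le)
    also have "\<dots> \<le> exp (- t * sqrt (real n) * \<epsilon> / (8 * (t + 1) * Lp_norm PZ 2 \<xi>) * frak_f n t)"
    proof -
      \<comment> \<open>As t / (t + 1) \<le> 1, the coefficient of \<open>s\<close> is at most 1/8 *
        6/25 = 3/100, exactly the rate delivered by \<open>link_exponent\<close>.\<close>
      have "t / (8 * (t + 1)) * frak_f n t \<le> 1/8 * (6/25)"
        using t frak_f_bounds[OF t, of n] by (intro mult_mono) (auto simp: divide_le_eq)
      then have "t / (8 * (t + 1)) * frak_f n t * s \<le> 1/8 * (6/25) * s" using s0 by (rule mult_right_mono)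
      moreover have "t / (8 * (t + 1)) * frak_f n t * s
          = t * sqrt n * \<epsilon> / (8 * (t + 1) * Lp_norm PZ 2 \<xi>) * frak_f n t"
        by (simp add: s_def \<tau>_def)
      ultimately have le: "t * sqrt n * \<epsilon> / (8 * (t + 1) * Lp_norm PZ 2 \<xi>) * frak_f n t \<le> 3/100 * s"
        by linarith
      have "- t * sqrt n * \<epsilon> / (8 * (t + 1) * Lp_norm PZ 2 \<xi>) * frak_f n t
          = - (t * sqrt n * \<epsilon> / (8 * (t + 1) * Lp_norm PZ 2 \<xi>) * frak_f n t)" by simp
      with le show ?thesis unfolding exp_le_cancel_iff by linarith
    qed
    finally show ?thesis by simp
  qed
  ultimately show ?thesis unfolding S_eq by blast
qed

end
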